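(* Let $X = X(\Sigma)$ be a complete Gorenstein toric variety of dimension $d$ with lattice $N$, let $\Psi_K$ be the associated piecewise linear function on $N_{\mathbb{R}}$, and let $Q = \{v \in N_{\mathbb{R}} : \Psi_K(v) \le 1\}$, with $\delta$-vector $\delta_Q = (\delta_0, \ldots, \delta_d)$. If $\mathcal{T}$ is any triangulation of the boundary of $Q$ whose vertices are in $N$, and $\Delta$ is the fan over the faces of $\mathcal{T}$, then $$\delta_Q = h_{\mathcal{T}} + \sum_{F \in \mathcal{T},\ v \in \mathrm{Box}(F) \cap N} h_{\Delta_F}[\Psi_K(v)],$$ where the sum is over all pairs $(F,v)$ with $F$ a nonempty face of $\mathcal{T}$ and $v \in \mathrm{Box}(F) \cap N$.
   Context: Toric setting. Let $N$ be a lattice of rank $d$, $N_{\mathbb{R}} = N \otimes_{\mathbb{Z}} \mathbb{R}$, and let $\Sigma$ be a complete fan of strongly convex rational polyhedral cones in $N_{\mathbb{R}}$, with toric variety $X(\Sigma)$. $X(\Sigma)$ is Gorenstein exactly when there is a (necessarily unique) function $\Psi_K : N_{\mathbb{R}} \to \mathbb{R}$ whose restriction to each cone of $\Sigma$ is given by an element of the dual lattice $\mathrm{Hom}(N, \mathbb{Z})$, and such that $\Psi_K(v_i) = 1$ for every primitive lattice generator $v_i$ of a ray of $\Sigma$. The region $Q$. Put $Q = \{v \in N_{\mathbb{R}} : \Psi_K(v) \le 1\}$ and $mQ = \{v \in N_{\mathbb{R}}: \Psi_K(v) \le m\}$ for integers $m \ge 0$. For each $\sigma \in \Sigma$, $Q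 \cap \sigma$ is the convex hull of the origin and the primitive generators of the rays of $\sigma$; $Q$ is homeomorphic to a $d$-dimensional ball (not necessarily convex), with boundary $\{\Psi_K = 1\}$. For integers $m \ge 0$, $f_Q(m) = \#(mQ \cap N)$ is a polynomial in $m$ of degree $d$, and $\delta_Q = (\delta_0,\ldots,\delta_d)$ is defined by $$\sum_{m \ge 0} f_Q(m) t^m = \frac{\delta_0 + \delta_1 t + \cdots + \delta_d t^d}{(1-t)^{d+1}}.$$ Triangulation data. A triangulation $\mathcal{T}$ of the boundary of $Q$ with vertices in $N$ is a finite geometric simplicial complex in $N_{\mathbb{R}}$ with all vertices in $N$ whose union is the boundary of $Q$. $\Delta$ is the complete simplicial fan whose cones are the cones over the faces of $\mathcal{T}$ (the empty face giving the cone $\{0\}$). For a face $F \in \mathcal{T}$ with vertices $v_1, \ldots, v_r$: - $\mathrm{Box}(F) = \{a_1 v_1 + \cdots + a_r v_r \in N_{\mathbb{R}} : 0 < a_i < 1 \text{ for all } i\}$; - $\Delta_F$ is the complete simplicial fan, for the lattice $N/(N \cap \mathrm{span}\, F)$ of rank $d - r$, whose cones are the images under projection of the cones of $\Delta$ containing $F$. $h$-vectors. For a complete simplicial fan $\Delta'$ of dimension $n$, the $h$-vector $h_{\Delta'} = (h_0, \ldots, h_n)$ is defined by $\sum_{i} h_i t^i = \sum_{\tau \in \Delta'} t^{\dim \tau} (1-t)^{n - \dim \tau}$ (sum over all cones, including $\{0\}$); for $n = 0$ it is $(1)$. $h_{\mathcal{T}}$ is the $h$-vector of the simplicial complex $\mathcal{T}$,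 equal to $h_\Delta$. For a positive integer $m$, $h_{\Delta_F}[m]$ is the shifted vector with $h_{\Delta_F}[m]_i = 0$ for $i < m$ and $h_{\Delta_F}[m]_i = (h_{\Delta_F})_{i-m}$ for $i \ge m$ (entries of $h_{\Delta_F}$ outside its range are $0$). All vectors are regarded as vectors indexed by $0 \le i \le d$, and the sum is entrywise. For $v \in \mathrm{Box}(F) \cap N$ with $F$ nonempty, $\Psi_K(v)$ is a positive integer. *)

theory Defs
  imports
    "HOL-Analysis.Analysis"
    "HOL-Computational_Algebra.Polynomial_FPS"
begin

section \<open>Lattices and complete Gorenstein fans\<close>

text \<open>
  A lattice is embedded in some Euclidean space as the group of integral combinations of linearly
  independent vectors. These need not span the ambient space (so rank \<open>0\<close> is allowed), and
  \<open>span N\<close> is the real vector space \<open>N \<otimes> \<real>\<close>.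
\<close>

definition is_lattice :: "nat \<Rightarrow> 'a::euclidean_space set \<Rightarrow> bool" where
  "is_lattice d N \<longleftrightarrow>
     (\<exists>B. independent B \<and> card B = d \<and> N = {(\<Sum>b\<in>B. of_int (c b) *\<^sub>R b) | c. True})"

definition primitive_in :: "'a::euclidean_space set \<Rightarrow> 'a \<Rightarrow> bool" where
  "primitive_in N v \<longleftrightarrow>
     v \<in> N \<and> v \<noteq> 0 \<and> \<not> (\<exists>w\<in>N. \<exists>k::nat. k \<ge> 2 \<and> v = of_nat k *\<^sub>R w)"

definition sc_rational_cone :: "'a::euclidean_space set \<Rightarrow> 'a set \<Rightarrow> bool" where
  "sc_rational_cone N \<sigma> \<longleftrightarrow>
     (\<exists>S. finite S \<and> S \<subseteq> N \<and> \<sigma> = convex_cone hull S) \<and> \<sigma> \<inter> uminus ` \<sigma> = {0}"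

text \<open>The empty set counts as a face in the library, but is not a face of a cone.\<close>

definition is_fan :: "'a::euclidean_space set \<Rightarrow> 'a set set \<Rightarrow> bool" where
  "is_fan N \<Sigma> \<longleftrightarrow>
     finite \<Sigma> \<and> \<Sigma> \<noteq> {} \<and>
     (\<forall>\<sigma>\<in>\<Sigma>. sc_rational_cone N \<sigma>) \<and>
     (\<forall>\<sigma>\<in>\<Sigma>. \<forall>\<tau>. \<tau> face_of \<sigma> \<and> \<tau> \<noteq> {} \<longrightarrow> \<tau> \<in> \<Sigma>) \<and>
     (\<forall>\<sigma>\<in>\<Sigma>. \<forall>\<tau>\<in>\<Sigma>. (\<sigma> \<inter> \<tau>) face_of \<sigma> \<and> (\<sigma> \<inter> \<tau>) face_of \<tau>)"

definition complete_fan :: "'a::euclidean_space set \<Rightarrow> 'a set set \<Rightarrow> bool" where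
  "complete_fan N \<Sigma> \<longleftrightarrow> is_fan N \<Sigma> \<and> \<Union>\<Sigma> = span N"

text \<open>
  The piecewise linear function \<open>\<Psi>\<^sub>K\<close>. An element of \<open>Hom(N, \<int>)\<close> is represented by a
  linear form on the ambient space that is integral on \<open>N\<close>. The toric variety of a complete fan
  \<open>\<Sigma>\<close> is Gorenstein if and only if some \<open>\<Psi>\<close> satisfies this predicate; its values on
  \<open>span N\<close> are then unique, and its values elsewhere are irrelevant.
\<close>

definition gorenstein_support :: "'a::euclidean_space set \<Rightarrow> 'a set set \<Rightarrow> ('a \<Rightarrow> real) \<Rightarrow> bool" where
  "gorenstein_support N \<Sigma> \<Psi> \<longleftrightarrow>
     (\<forall>\<sigma>\<in>\<Sigma>. \<exists>u::'a \<Rightarrow> real. linear u \<and> (\<forall>x\<in>N. u x \<in> \<int>) \<and> (\<forall>x\<in>\<sigma>. \<Psi> x = u x)) \<and>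
     (\<forall>\<rho>\<in>\<Sigma>. dim \<rho> = 1 \<longrightarrow> (\<forall>v\<in>\<rho>. primitive_in N v \<longrightarrow> \<Psi> v = 1))"

section \<open>The region \<open>Q\<close> and its \<open>\<delta>\<close>-vector\<close>

definition region :: "'a::euclidean_space set \<Rightarrow> ('a \<Rightarrow> real) \<Rightarrow> nat \<Rightarrow> 'a set" where
  "region N \<Psi> m = {v \<in> span N. \<Psi> v \<le> real m}"

definition ehrhart :: "'a::euclidean_space set \<Rightarrow> ('a \<Rightarrow> real) \<Rightarrow> nat \<Rightarrow> nat" where
  "ehrhart N \<Psi> m = card (region N \<Psi> m \<inter> N)"

text \<open>
  The numerator \<open>\<delta>\<^sub>0 + \<dots> + \<delta>\<^sub>d t\<^sup>d\<close> of the generating series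
  \<open>\<Sum> f m t\<^sup>m\<close> over the denominator \<open>(1 - t)\<^bsup>d+1\<^esup>\<close>.
\<close>

definition delta_poly :: "nat \<Rightarrow> (nat \<Rightarrow> nat) \<Rightarrow> int poly" where
  "delta_poly d f =
     (THE p. degree p \<le> d \<and>
        Abs_fps (\<lambda>m. int (f m)) * (1 - fps_X) ^ (d + 1) = fps_of_poly p)"

definition delta_vector :: "'a::euclidean_space set \<Rightarrow> ('a \<Rightarrow> real) \<Rightarrow> nat \<Rightarrow> nat \<Rightarrow> int" where
  "delta_vector N \<Psi> d i = coeff (delta_poly d (ehrhart N \<Psi>)) i"

section \<open>Lattice triangulations of the boundary\<close>

text \<open>
  The boundary of \<open>Q\<close> is its topological boundary in \<open>span N\<close>. The empty face belongs to
  every triangulation; this only needs to be said because the boundary is empty in rank \<open>0\<close>.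
\<close>

definition boundary_triangulation ::
    "'a::euclidean_space set \<Rightarrow> ('a \<Rightarrow> real) \<Rightarrow> 'a set set \<Rightarrow> bool" where
  "boundary_triangulation N \<Psi> \<T> \<longleftrightarrow>
     simplicial_complex \<T> \<and> {} \<in> \<T> \<and>
     (\<forall>v. {v} \<in> \<T> \<longrightarrow> v \<in> N) \<and>
     \<Union>\<T> = top_of_set (span N) frontier_of region N \<Psi> 1"

definition vertices :: "'a::euclidean_space set \<Rightarrow> 'a set" where
  "vertices F = {v. v extreme_point_of F}"

definition Box :: "'a::euclidean_space set \<Rightarrow> 'a set" where
  "Box F = {(\<Sum>v\<in>vertices F. a v *\<^sub>R v) | a::'a \<Rightarrow> real. \<forall>v\<in>vertices F. 0 < a v \<and> a v < 1}"

definition cone_fan :: "'a::euclidean_space set set \<Rightarrow> 'a set set" where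
  "cone_fan \<T> = (\<lambda>F. convex_cone hull F) ` \<T>"

text \<open>
  The quotient of \<open>span N\<close> by \<open>span F\<close> is identified with the orthogonal complement of
  \<open>span F\<close> in \<open>span N\<close>, so that the quotient map becomes the orthogonal projection.
\<close>

definition project_mod :: "'a::euclidean_space set \<Rightarrow> 'a set \<Rightarrow> 'a set" where
  "project_mod F \<sigma> = {y \<in> (span F)\<^sup>\<bottom>. \<exists>x\<in>\<sigma>. x - y \<in> span F}"

definition link_fan :: "'a::euclidean_space set set \<Rightarrow> 'a set \<Rightarrow> 'a set set" where
  "link_fan \<Delta> F = project_mod F ` {\<sigma> \<in> \<Delta>. F \<subseteq> \<sigma>}"

section \<open>\<open>h\<close>-vectors\<close>

definition fan_h :: "nat \<Rightarrow> 'a::euclidean_space set set \<Rightarrow> nat \<Rightarrow> int" where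
  "fan_h n \<Delta> i = coeff (\<Sum>\<tau>\<in>\<Delta>. [:0, 1:] ^ dim \<tau> * [:1, -1:] ^ (n - dim \<tau>)) i"

text \<open>For a simplicial complex of dimension \<open>n - 1\<close>.\<close>

definition complex_h :: "nat \<Rightarrow> 'a::euclidean_space set set \<Rightarrow> nat \<Rightarrow> int" where
  "complex_h n \<T> i =
     coeff (\<Sum>F\<in>\<T>. [:0, 1:] ^ card (vertices F) * [:1, -1:] ^ (n - card (vertices F))) i"

definition shift :: "(nat \<Rightarrow> int) \<Rightarrow> nat \<Rightarrow> nat \<Rightarrow> int" where
  "shift h m i = (if i < m then 0 else h (i - m))"

end

theory Submission
  imports Defs
begin

text \<open>
  Since \<open>\<Psi>\<close> is positively homogeneous and positive away from the origin, the boundary of \<open>Q\<close> is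
  \<open>{\<Psi> = 1}\<close>, every vector of \<open>span N\<close> lies in the open cone over a unique face \<open>F\<close> of \<open>\<T>\<close>, and on that
  cone \<open>\<Psi>\<close> is the sum of the coefficients with respect to the vertices of \<open>F\<close>, even if \<open>F\<close> is not
  contained in a cone of \<open>\<Sigma>\<close>. Splitting coefficients into fractional and integral parts, a lattice point of
  the open cone over \<open>F\<close> is uniquely a box point of a face \<open>G\<close> of \<open>F\<close>, plus the sum of the vertices of \<open>F\<close>
  outside \<open>G\<close>, plus a nonnegative integral combination of the vertices of \<open>F\<close>. Hence
  \<open>(1 - t)\<^bsup>d+1\<^esup> \<Sum>\<^sub>m f\<^sub>Q(m) t\<^sup>m\<close> is the sum over \<open>G \<subseteq> F\<close> and box points \<open>w\<close> of \<open>G\<close> of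
  \<open>t\<^bsup>\<Psi>(w)\<^esup> t\<^bsup>|F|-|G|\<^esup> (1 - t)\<^bsup>d-|F|\<^esup>\<close>, and for fixed \<open>G\<close> the sum over \<open>F\<close> is the \<open>h\<close>-polynomial
  of \<open>\<Delta>\<^sub>G\<close>.
\<close>

unbundle no vec_syntax
unbundle fps_syntax

section \<open>Lattices and cones\<close>

lemma is_lattice_diff:
  assumes "is_lattice d N" "x \<in> N" "y \<in> N"
  shows "x - y \<in> N"
proof -
  obtain B where N: "N = {(\<Sum>b\<in>B. of_int (c b) *\<^sub>R b) | c. True}"
    using assms(1) unfolding is_lattice_def by blast
  obtain c e where "x = (\<Sum>b\<in>B. of_int (c b) *\<^sub>R b)" "y = (\<Sum>b\<in>B. of_int (e b) *\<^sub>R b)"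
    using assms(2,3) unfolding N by blast
  then have "x - y = (\<Sum>b\<in>B. of_int (c b - e b) *\<^sub>R b)"
    by (simp add: sum_subtractf scaleR_diff_left)
  then show ?thesis unfolding N by (intro CollectI exI[of _ "\<lambda>b. c b - e b"]) simp
qed

lemma is_lattice_nonempty: "is_lattice d N \<Longrightarrow> N \<noteq> {}"
  unfolding is_lattice_def by blast

lemma is_lattice_zero: "is_lattice d N \<Longrightarrow> 0 \<in> N"
  using is_lattice_diff by (metis (no_types, lifting) cancel_comm_monoid_add_class.diff_cancel is_lattice_nonempty ex_in_conv)

lemma is_lattice_add:
  assumes "is_lattice d N" "x \<in> N" "y \<in> N"
  shows "x + y \<in> N"
  using is_lattice_diff[OF assms(1,2) is_lattice_diff[OF assms(1) is_lattice_zero[OF assms(1)] assms(3)]]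
  by simp

lemma is_lattice_sum:
  assumes "is_lattice d N" "\<And>i. i \<in> I \<Longrightarrow> f i \<in> N"
  shows "sum f I \<in> N"
  using assms(2)
  by (induction I rule: infinite_finite_induct)
     (simp_all add: is_lattice_zero[OF assms(1)] is_lattice_add[OF assms(1)])

lemma is_lattice_dim:
  assumes "is_lattice d N"
  shows "dim (span N) = d"
proof -
  obtain B where B: "independent B" "card B = d" "N = {(\<Sum>b\<in>B. of_int (c b) *\<^sub>R b) | c. True}"
    using assms unfolding is_lattice_def by blast
  have "finite B" using B(1) by (rule independent_imp_finite)
  have "B \<subseteq> N"
  proof
    fix b assume "b \<in> B"
    have "(\<Sum>b'\<in>B. of_int (if b' = b then 1 else 0) *\<^sub>R b') = (\<Sum>b'\<in>B. if b' = b then b' else 0)"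
      by (intro sum.cong) auto
    also have "\<dots> = b" using \<open>b \<in> B\<close> \<open>finite B\<close> by simp
    finally show "b \<in> N" unfolding B(3) by (intro CollectI exI[of _ "\<lambda>b'. if b' = b then 1 else 0"]) simp
  qed
  moreover have "N \<subseteq> span B"
    unfolding B(3) by (auto intro: span_sum span_scale span_base)
  ultimately have "span N = span B"
    by (metis span_mono span_span subset_antisym)
  then show ?thesis using B(1,2) by (simp add: dim_eq_card_independent)
qed

text \<open>Coordinates with respect to the lattice basis extend to linear forms on the ambient
  space, and these are bounded on \<open>K\<close>; so the integral coordinates of a lattice point
  in \<open>K\<close> range over a finite box.\<close>

lemma finite_lattice_bounded:
  assumes "is_lattice d N" "bounded K"
  shows "finite (N \<inter> K)"
proof -
  obtain B where B: "independent B" "N = {(\<Sum>b\<in>B. of_int (c b) *\<^sub>R b) | c. True}"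
    using assms(1) unfolding is_lattice_def by blast
  have fB: "finite B" using B(1) by (rule independent_imp_finite)
  have "\<forall>b. \<exists>g::'a \<Rightarrow> real. linear g \<and> (\<forall>x\<in>B. g x = (if x = b then 1 else 0))"
    using B(1) by (intro allI linear_independent_extend)
  then obtain g :: "'a \<Rightarrow> 'a \<Rightarrow> real"
    where g: "\<And>b. linear (g b)" "\<And>b x. x \<in> B \<Longrightarrow> g b x = (if x = b then 1 else 0)"
    by metis
  have "\<exists>C. \<forall>x\<in>K. \<bar>g b x\<bar> \<le> C" for b
    using bounded_linear_image[OF assms(2), of "g b"] g(1)
    by (auto simp: bounded_iff linear_conv_bounded_linear)
  then obtain C where C: "\<And>b x. x \<in> K \<Longrightarrow> \<bar>g b x\<bar> \<le> C b" by metis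
  have "N \<inter> K \<subseteq> (\<lambda>c. \<Sum>b\<in>B. of_int (c b) *\<^sub>R b) ` (Pi\<^sub>E B (\<lambda>b. {- \<lceil>C b\<rceil>..\<lceil>C b\<rceil>}))"
  proof
    fix x assume x: "x \<in> N \<inter> K"
    then obtain c where c: "x = (\<Sum>b\<in>B. of_int (c b) *\<^sub>R b)" unfolding B(2) by blast
    have "of_int (c b) = g b x" if "b \<in> B" for b
    proof -
      have "g b x = (\<Sum>b'\<in>B. of_int (c b') * g b b')"
        unfolding c by (simp add: linear_sum[OF g(1)] linear_cmul[OF g(1)])
      also have "\<dots> = (\<Sum>b'\<in>B. if b' = b then of_int (c b') else 0)"
        by (intro sum.cong) (auto simp: g(2))
      finally show ?thesis using that fB by simp
    qed
    then have "\<bar>of_int (c b)\<bar> \<le> C b" if "b \<in> B" for b using C[of x b] x that by simp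
    then have "c b \<in> {- \<lceil>C b\<rceil>..\<lceil>C b\<rceil>}" if "b \<in> B" for b
      using that by (simp add: abs_le_iff) (smt (verit) ceiling_correct of_int_less_iff of_int_minus le_of_int_ceiling of_int_le_iff)
    then have "restrict c B \<in> Pi\<^sub>E B (\<lambda>b. {- \<lceil>C b\<rceil>..\<lceil>C b\<rceil>})" by simp
    then show "x \<in> (\<lambda>c. \<Sum>b\<in>B. of_int (c b) *\<^sub>R b) ` (Pi\<^sub>E B (\<lambda>b. {- \<lceil>C b\<rceil>..\<lceil>C b\<rceil>}))"
      by (intro image_eqI[of _ _ "restrict c B"]) (simp_all add: c)
  qed
  moreover have "finite (Pi\<^sub>E B (\<lambda>b. {- \<lceil>C b\<rceil>..\<lceil>C b\<rceil>}))" using fB by (intro finite_PiE) auto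
  ultimately show ?thesis by (meson finite_surj)
qed

text \<open>Among the lattice vectors having \<open>s\<close> as a positive integral multiple take a
  shortest one; there are finitely many, all of norm at most \<open>norm s\<close>. If it were
  divisible by some \<open>k \<ge> 2\<close>, the quotient would be a shorter candidate.\<close>

lemma primitive_multiple:
  assumes "is_lattice d N" "s \<in> N" "s \<noteq> 0"
  obtains v and k :: nat where "primitive_in N v" "k \<ge> 1" "s = of_nat k *\<^sub>R v"
proof -
  let ?W = "{w \<in> N. \<exists>k::nat. k \<ge> 1 \<and> s = of_nat k *\<^sub>R w}"
  have "norm w \<le> norm s" if "k \<ge> 1" "s = of_nat k *\<^sub>R w" for w and k :: nat
    using that mult_right_mono[of 1 "real k" "norm w"] by simp
  then have "?W \<subseteq> N \<inter> cball 0 (norm s)" by auto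
  then have fin: "finite ?W"
    using finite_lattice_bounded[OF assms(1) bounded_cball] finite_subset by blast
  have "s \<in> ?W" using assms(2) by (auto intro: exI[of _ 1])
  then have "Min (norm ` ?W) \<in> norm ` ?W" using fin by (intro Min_in) auto
  then obtain w where w: "w \<in> ?W" "norm w = Min (norm ` ?W)" by (metis (no_types, lifting) imageE)
  have wmin: "norm w \<le> norm w'" if "w' \<in> ?W" for w'
    using that fin unfolding w(2) by (intro Min_le) auto
  then obtain k :: nat where k: "k \<ge> 1" "s = of_nat k *\<^sub>R w" using w(1) by blast
  have "w \<noteq> 0" using k assms(3) by auto
  have "\<not> (\<exists>w'\<in>N. \<exists>k::nat. k \<ge> 2 \<and> w = of_nat k *\<^sub>R w')"
  proof
    assume "\<exists>w'\<in>N. \<exists>k::nat. k \<ge> 2 \<and> w = of_nat k *\<^sub>R w'"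
    then obtain w' and k' :: nat where w': "w' \<in> N" "k' \<ge> 2" "w = of_nat k' *\<^sub>R w'" by auto
    have "s = of_nat (k * k') *\<^sub>R w'" using k w' by simp
    moreover have "k * k' \<ge> 1" using k(1) w'(2) by auto
    ultimately have "w' \<in> ?W" using w'(1) by blast
    then have "norm w \<le> norm w'" by (rule wmin)
    moreover have "norm w = of_nat k' * norm w'" using w'(3) by simp
    moreover have "norm w' > 0" using \<open>w \<noteq> 0\<close> w'(3) by auto
    moreover have "of_nat k' * norm w' \<ge> 2 * norm w'" using w'(2) by (intro mult_right_mono) auto
    ultimately show False by simp
  qed
  then have "primitive_in N w" using w(1) \<open>w \<noteq> 0\<close> unfolding primitive_in_def by blast
  then show ?thesis using k that by blast
qed

section \<open>Finitely generated cones and their rays\<close>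

lemma convex_cone_hull_finite:
  fixes S :: "'a::real_vector set"
  assumes "finite S"
  shows "convex_cone hull S = {(\<Sum>s\<in>S. c s *\<^sub>R s) | c. \<forall>s\<in>S. 0 \<le> c s}" (is "_ = ?R")
proof (rule hull_unique)
  show "S \<subseteq> ?R"
  proof
    fix s assume s: "s \<in> S"
    have "(\<Sum>t\<in>S. (if t = s then 1 else 0) *\<^sub>R t) = (\<Sum>t\<in>S. if t = s then t else 0)"
      by (intro sum.cong) auto
    also have "\<dots> = s" using s assms by simp
    finally show "s \<in> ?R" by (intro CollectI exI[of _ "\<lambda>t. if t = s then 1 else 0"]) simp
  qed
  show "convex_cone ?R"
    unfolding convex_cone_iff
  proof (intro conjI ballI allI impI)
    show "0 \<in> ?R" by (intro CollectI exI[of _ "\<lambda>_. 0"]) simp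
    fix x y assume "x \<in> ?R" "y \<in> ?R"
    then obtain a b where ab: "x = (\<Sum>s\<in>S. a s *\<^sub>R s)" "\<forall>s\<in>S. 0 \<le> a s"
       "y = (\<Sum>s\<in>S. b s *\<^sub>R s)" "\<forall>s\<in>S. 0 \<le> b s" by blast
    then show "x + y \<in> ?R"
      by (intro CollectI exI[of _ "\<lambda>s. a s + b s"]) (simp add: scaleR_add_left sum.distrib)
  next
    fix x and r :: real assume "x \<in> ?R" "0 \<le> r"
    then obtain a where ab: "x = (\<Sum>s\<in>S. a s *\<^sub>R s)" "\<forall>s\<in>S. 0 \<le> a s" by blast
    then show "r *\<^sub>R x \<in> ?R" using \<open>0 \<le> r\<close>
      by (intro CollectI exI[of _ "\<lambda>s. r * a s"]) (simp add: scaleR_sum_right)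
  qed
  fix K assume K: "S \<subseteq> K" "convex_cone K"
  have "(\<Sum>s\<in>S. c s *\<^sub>R s) \<in> K" if "\<forall>s\<in>S. 0 \<le> c s" for c
    using assms K(1) that
    by (induction S rule: finite_induct)
       (use K(2) in \<open>auto simp: convex_cone_contains_0 intro!: convex_cone_add convex_cone_scaleR\<close>)
  then show "?R \<subseteq> K" by blast
qed

lemma convex_cone_hull_insert:
  fixes s :: "'a::real_vector"
  assumes "finite S" "x \<in> convex_cone hull (insert s S)"
  obtains a y where "0 \<le> a" "y \<in> convex_cone hull S" "x = a *\<^sub>R s + y"
proof (cases "s \<in> S")
  case True
  then show ?thesis using assms(2) that[of 0 x] by (simp add: insert_absorb)
next
  case False
  have "finite (insert s S)" using assms(1) by simp
  then obtain c where c: "x = (\<Sum>t\<in>insert s S. c t *\<^sub>R t)" "\<forall>t\<in>insert s S. 0 \<le> c t"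
    using assms(2) unfolding convex_cone_hull_finite[OF \<open>finite (insert s S)\<close>] by blast
  have "x = c s *\<^sub>R s + (\<Sum>t\<in>S. c t *\<^sub>R t)" using c(1) assms(1) False by simp
  moreover have "(\<Sum>t\<in>S. c t *\<^sub>R t) \<in> convex_cone hull S"
    using c(2) unfolding convex_cone_hull_finite[OF assms(1)] by blast
  ultimately show ?thesis using c(2) that by blast
qed

text \<open>If two points of the cone add up to a multiple of \<open>s\<close>, splitting off
  multiples of \<open>s\<close> leaves \<open>x'\<close> and \<open>y'\<close> in the cone over
  \<open>S\<close> with \<open>x' + y' = e *\<^sub>R s\<close>. For \<open>e > 0\<close> this would
  put \<open>s\<close> into the cone over \<open>S\<close>; for \<open>e \<le> 0\<close> pointedness
  forces \<open>x' + y' = 0\<close> and then \<open>x' = 0\<close>.\<close>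

lemma ray_face_of_pointed_cone:
  fixes s :: "'a::real_vector"
  assumes "finite S" and \<sigma>: "\<sigma> = convex_cone hull (insert s S)"
    and pointed: "\<sigma> \<inter> uminus ` \<sigma> = {0}" and s: "s \<notin> convex_cone hull S"
  shows "convex_cone hull {s} face_of \<sigma>"
proof -
  have ray: "convex_cone hull {s} = {c *\<^sub>R s | c. 0 \<le> c}"
  proof -
    have "convex_cone hull {s} = {f s *\<^sub>R s | f. 0 \<le> f s}"
      by (subst convex_cone_hull_finite) simp_all
    also have "\<dots> = {c *\<^sub>R s | c. 0 \<le> c}"
    proof (intro equalityI subsetI)
      fix x assume "x \<in> {c *\<^sub>R s | c. 0 \<le> c}"
      then obtain c where "x = c *\<^sub>R s" "0 \<le> c" by blast
      then show "x \<in> {f s *\<^sub>R s | f. 0 \<le> f s}" by (intro CollectI exI[of _ "\<lambda>_. c"]) simp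
    qed blast
    finally show ?thesis .
  qed
  have sub: "convex_cone hull S \<subseteq> \<sigma>" unfolding \<sigma> by (intro hull_mono) auto
  have zero: "x = 0" if "x \<in> \<sigma>" "y \<in> \<sigma>" "x + y = 0" for x y
  proof -
    have "x = - y" using that(3) by (simp add: eq_neg_iff_add_eq_0)
    then have "x \<in> \<sigma> \<inter> uminus ` \<sigma>" using that by auto
    then show ?thesis using pointed by auto
  qed
  have key: "x \<in> convex_cone hull {s}" if x: "x \<in> \<sigma>" and y: "y \<in> \<sigma>" and xy: "x + y = c *\<^sub>R s" for x y c
  proof -
    obtain a x' where a: "0 \<le> a" "x' \<in> convex_cone hull S" "x = a *\<^sub>R s + x'"
      using convex_cone_hull_insert[OF assms(1) x[unfolded \<sigma>]] by blast
    obtain b y' where b: "0 \<le> b" "y' \<in> convex_cone hull S" "y = b *\<^sub>R s + y'"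
      using convex_cone_hull_insert[OF assms(1) y[unfolded \<sigma>]] by blast
    define e where "e = c - a - b"
    have e: "x' + y' = e *\<^sub>R s"
      using xy a(3) b(3) by (simp add: e_def algebra_simps)
    have xy': "x' + y' \<in> convex_cone hull S" using a(2) b(2) by (rule convex_cone_hull_add)
    have "e \<le> 0"
    proof (rule ccontr)
      assume "\<not> e \<le> 0"
      then have "s = inverse e *\<^sub>R (x' + y')" using e by simp
      then have "s \<in> convex_cone hull S"
        using convex_cone_hull_mul[OF xy', of "inverse e"] \<open>\<not> e \<le> 0\<close> by simp
      then show False using s by simp
    qed
    have sS: "s \<in> \<sigma>" unfolding \<sigma> by (simp add: hull_inc)
    have "(- e) *\<^sub>R s \<in> \<sigma>" using sS \<open>e \<le> 0\<close> unfolding \<sigma> by (intro convex_cone_hull_mul) auto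
    then have "x' + y' = 0" using zero[of "x' + y'" "(- e) *\<^sub>R s"] xy' sub e by auto
    then have "x' = 0" using zero[of x' y'] a(2) b(2) sub by auto
    then show ?thesis using a unfolding ray by auto
  qed
  show ?thesis
    unfolding face_of_def
  proof (intro conjI ballI impI)
    show "convex_cone hull {s} \<subseteq> \<sigma>" unfolding \<sigma> by (intro hull_mono) auto
    show "convex (convex_cone hull {s})" by (rule convex_convex_cone_hull)
    fix x y z assume x: "x \<in> \<sigma>" and y: "y \<in> \<sigma>" and z: "z \<in> convex_cone hull {s}" "z \<in> open_segment x y"
    obtain u where u: "0 < u" "u < 1" "z = (1 - u) *\<^sub>R x + u *\<^sub>R y"
      using z(2) by (auto simp: in_segment)
    obtain c where c: "z = c *\<^sub>R s" using z(1) unfolding ray by auto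
    \<comment> \<open>\<open>key\<close> is about sums, so the point \<open>z\<close> of the segment
      is viewed as the sum of the two scaled endpoints; the scaling is undone afterwards.\<close>
    have X: "(1 - u) *\<^sub>R x \<in> \<sigma>" using x u unfolding \<sigma> by (intro convex_cone_hull_mul) auto
    have Y: "u *\<^sub>R y \<in> \<sigma>" using y u unfolding \<sigma> by (intro convex_cone_hull_mul) auto
    have "(1 - u) *\<^sub>R x \<in> convex_cone hull {s}" using key[OF X Y, of c] u(3) c by simp
    then have "inverse (1 - u) *\<^sub>R ((1 - u) *\<^sub>R x) \<in> convex_cone hull {s}"
      using u by (intro convex_cone_hull_mul[of "(1 - u) *\<^sub>R x"]) auto
    then show "x \<in> convex_cone hull {s}" using u by simp
    have "u *\<^sub>R y \<in> convex_cone hull {s}" using key[OF Y X, of c] u(3) c by (simp add: add.commute)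
    then have "inverse u *\<^sub>R (u *\<^sub>R y) \<in> convex_cone hull {s}"
      using u by (intro convex_cone_hull_mul[of "u *\<^sub>R y"]) auto
    then show "y \<in> convex_cone hull {s}" using u by simp
  qed
qed

text \<open>Take \<open>M\<close> minimal under inclusion among the subsets of \<open>S\<close> that
  generate the cone. If the cone is pointed, each element of \<open>M\<close> spans a ray that is a
  face, by \<open>ray_face_of_pointed_cone\<close>.\<close>

lemma minimal_cone_generators:
  fixes S :: "'a::real_vector set"
  assumes "finite S"
  obtains M where "M \<subseteq> S" "convex_cone hull M = convex_cone hull S"
    "\<And>s. s \<in> M \<Longrightarrow> s \<notin> convex_cone hull (M - {s})"
proof -
  let ?C = "{M. M \<subseteq> S \<and> convex_cone hull M = convex_cone hull S}"
  have "?C \<subseteq> Pow S" by blast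
  then have C: "finite ?C" using assms by (simp add: finite_subset)
  have "S \<in> ?C" by blast
  with C obtain M where M: "M \<in> ?C" "\<And>M'. M' \<in> ?C \<Longrightarrow> M' \<subseteq> M \<Longrightarrow> M = M'"
    using finite_has_minimal2[of ?C S] by (metis (no_types, lifting))
  have "s \<notin> convex_cone hull (M - {s})" if s: "s \<in> M" for s
  proof
    assume "s \<in> convex_cone hull (M - {s})"
    then have "convex_cone hull (M - {s}) = convex_cone hull M"
      using hull_redundant[of s convex_cone "M - {s}"] insert_Diff[OF s] by metis
    then have "M - {s} \<in> ?C" using M(1) by blast
    then show False using M(2)[of "M - {s}"] s by blast
  qed
  then show ?thesis using M(1) that by blast
qed

lemma convex_cone_hull_convex_hull_eq: "convex_cone hull (convex hull S) = convex_cone hull S"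
  by (intro equalityI hull_minimal convex_hull_subset_convex_cone_hull convex_cone_convex_cone_hull
        hull_mono hull_subset)

lemma span_convex_hull: "span (convex hull S) = span S"
  by (metis convex_hull_subset_span hull_subset span_mono span_span subset_antisym)

section \<open>The support function of a complete Gorenstein fan\<close>

context
  fixes N :: "'a::euclidean_space set" and \<Sigma> :: "'a set set" and \<Psi> :: "'a \<Rightarrow> real" and d :: nat
  assumes lattice: "is_lattice d N" and fan: "complete_fan N \<Sigma>"
    and support: "gorenstein_support N \<Sigma> \<Psi>"
begin

lemma fan_cone:
  assumes "\<sigma> \<in> \<Sigma>"
  obtains S u where "finite S" "S \<subseteq> N" "\<sigma> = convex_cone hull S" "\<sigma> \<inter> uminus ` \<sigma> = {0}"
    "linear u" "\<And>x. x \<in> N \<Longrightarrow> u x \<in> \<int>" "\<And>x. x \<in> \<sigma> \<Longrightarrow> \<Psi> x = u x"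
proof -
  have "sc_rational_cone N \<sigma>"
    using assms fan unfolding complete_fan_def is_fan_def by simp
  then obtain S where S: "finite S" "S \<subseteq> N" "\<sigma> = convex_cone hull S" "\<sigma> \<inter> uminus ` \<sigma> = {0}"
    unfolding sc_rational_cone_def by (elim conjE exE)
  obtain u where u: "linear u" "\<forall>x\<in>N. u x \<in> \<int>" "\<forall>x\<in>\<sigma>. \<Psi> x = u x"
    using assms support unfolding gorenstein_support_def by metis
  show ?thesis by (rule that[OF S u(1)]) (simp_all add: u(2,3))
qed

lemma span_cone:
  assumes "x \<in> span N"
  obtains \<sigma> where "\<sigma> \<in> \<Sigma>" "x \<in> \<sigma>"
  using assms fan unfolding complete_fan_def by blast

lemma support_scaleR:
  assumes "x \<in> span N" "0 \<le> c"
  shows "\<Psi> (c *\<^sub>R x) = c * \<Psi> x"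
proof -
  obtain \<sigma> where \<sigma>: "\<sigma> \<in> \<Sigma>" "x \<in> \<sigma>" using assms(1) by (rule span_cone)
  obtain S u where S: "\<sigma> = convex_cone hull S" and u: "linear u" "\<And>x. x \<in> \<sigma> \<Longrightarrow> \<Psi> x = u x"
    using \<sigma>(1) by (rule fan_cone) blast
  have "c *\<^sub>R x \<in> \<sigma>" using \<sigma>(2) assms(2) unfolding S by (rule convex_cone_hull_mul)
  then show ?thesis using \<sigma>(2) u by (simp add: linear_cmul)
qed

lemma support_Ints:
  assumes "x \<in> N"
  shows "\<Psi> x \<in> \<int>"
proof -
  obtain \<sigma> where \<sigma>: "\<sigma> \<in> \<Sigma>" "x \<in> \<sigma>" using span_base[OF assms] by (rule span_cone)
  obtain u where u: "\<And>x. x \<in> N \<Longrightarrow> u x \<in> \<int>" "\<And>x. x \<in> \<sigma> \<Longrightarrow> \<Psi> x = u x"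
    using \<sigma>(1) by (rule fan_cone) blast
  show ?thesis using u(1)[OF assms] u(2)[OF \<sigma>(2)] by simp
qed

text \<open>
  A minimal generator \<open>s\<close> of a cone of the fan spans one of its rays, so \<open>s\<close> is a positive multiple of a
  primitive vector on which the support function is \<open>1\<close>.
\<close>

lemma support_pos:
  assumes "x \<in> span N" "x \<noteq> 0"
  shows "\<Psi> x > 0"
proof -
  obtain \<sigma> where \<sigma>: "\<sigma> \<in> \<Sigma>" "x \<in> \<sigma>" using assms(1) by (rule span_cone)
  obtain S u where S: "finite S" "S \<subseteq> N" "\<sigma> = convex_cone hull S" "\<sigma> \<inter> uminus ` \<sigma> = {0}"
    and u: "linear u" "\<And>x. x \<in> \<sigma> \<Longrightarrow> \<Psi> x = u x"
    using \<sigma>(1) by (rule fan_cone) blast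
  obtain M where M: "M \<subseteq> S" "convex_cone hull M = convex_cone hull S"
    "\<And>s. s \<in> M \<Longrightarrow> s \<notin> convex_cone hull (M - {s})"
    using minimal_cone_generators[OF S(1)] by blast
  have fM: "finite M" using M(1) S(1) by (rule finite_subset)
  have pos: "u s > 0" if s: "s \<in> M" for s
  proof -
    \<comment> \<open>Every convex cone hull contains the origin, so an irredundant generator is
      nonzero.\<close>
    have s0: "s \<noteq> 0" using M(3)[OF s] convex_cone_hull_contains_0 by metis
    have sN: "s \<in> N" using s M(1) S(2) by blast
    have s\<sigma>: "s \<in> \<sigma>" unfolding S(3) M(2)[symmetric] by (rule hull_inc[OF s])
    let ?\<rho> = "convex_cone hull {s}"
    have "\<sigma> = convex_cone hull (insert s (M - {s}))"
      unfolding S(3) M(2)[symmetric] using insert_Diff[OF s] by simp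
    then have "?\<rho> face_of \<sigma>"
      using ray_face_of_pointed_cone[of "M - {s}" \<sigma> s] fM S(4) M(3)[OF s] by blast
    moreover have "\<And>\<tau>. \<tau> face_of \<sigma> \<Longrightarrow> \<tau> \<noteq> {} \<Longrightarrow> \<tau> \<in> \<Sigma>"
      using \<sigma>(1) fan unfolding complete_fan_def is_fan_def by blast
    ultimately have \<rho>: "?\<rho> \<in> \<Sigma>" using convex_cone_hull_nonempty by metis
    have "{s} \<subseteq> ?\<rho>" "?\<rho> \<subseteq> span {s}"
      by (simp_all add: hull_subset hull_minimal span_superset convex_cone_span)
    then have "span ?\<rho> = span {s}" by (metis span_mono span_span subset_antisym)
    then have "dim ?\<rho> = 1" using s0 by (metis dim_span dim_singleton)
    obtain v and k :: nat where v: "primitive_in N v" "k \<ge> 1" "s = of_nat k *\<^sub>R v"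
      using primitive_multiple[OF lattice sN s0] by blast
    have "v = inverse (of_nat k) *\<^sub>R s" using v(2,3) by simp
    then have "v \<in> ?\<rho>" using convex_cone_hull_mul[of s "{s}" "inverse (of_nat k)"] by (simp add: hull_inc)
    then have "\<Psi> v = 1"
      using support \<rho> \<open>dim ?\<rho> = 1\<close> v(1) unfolding gorenstein_support_def by blast
    moreover have "v \<in> span N" using v(1) unfolding primitive_in_def by (auto intro: span_base)
    ultimately have "\<Psi> s = of_nat k" using v(3) support_scaleR[of v "of_nat k"] by simp
    then show ?thesis using u(2)[OF s\<sigma>] v(2) by simp
  qed
  obtain c where c: "x = (\<Sum>s\<in>M. c s *\<^sub>R s)" "\<forall>s\<in>M. 0 \<le> c s"
    using \<sigma>(2) unfolding S(3) M(2)[symmetric] convex_cone_hull_finite[OF fM] by blast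
  have "\<exists>s\<in>M. c s \<noteq> 0" using c(1) assms(2) by (metis (no_types, lifting) scale_zero_left sum.neutral)
  then obtain t where t: "t \<in> M" "c t > 0" using c(2) by force
  have "(\<Sum>s\<in>M. c s * u s) > 0"
    using t c(2) pos by (intro sum_pos2[OF fM t(1)]) (auto simp: less_imp_le)
  then show ?thesis
    using u(2)[OF \<sigma>(2)] c(1) by (simp add: linear_sum[OF u(1)] linear_cmul[OF u(1)])
qed

text \<open>Pasting: the cones of the fan are closed, finite in number and cover
  \<open>span N\<close>, and the function is linear on each.\<close>

lemma support_continuous: "continuous_on (span N) \<Psi>"
proof -
  have "continuous_on \<sigma> \<Psi>" if \<sigma>: "\<sigma> \<in> \<Sigma>" for \<sigma>
  proof -
    obtain u where u: "linear u" "\<And>x. x \<in> \<sigma> \<Longrightarrow> \<Psi> x = u x"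
      using \<sigma> by (rule fan_cone) blast
    have "continuous_on \<sigma> u" using u(1) by (simp add: linear_continuous_on linear_conv_bounded_linear)
    then show ?thesis by (rule continuous_on_eq) (simp add: u(2))
  qed
  moreover have "closed \<sigma>" if "\<sigma> \<in> \<Sigma>" for \<sigma>
    using that by (rule fan_cone) (simp add: closed_convex_cone_hull)
  moreover have "finite \<Sigma>" "span N = (\<Union>\<sigma>\<in>\<Sigma>. \<sigma>)"
    using fan unfolding complete_fan_def is_fan_def by auto
  ultimately show ?thesis using continuous_on_closed_Union[of \<Sigma> "\<lambda>\<sigma>. \<sigma>" \<Psi>] by metis
qed

text \<open>The region is closed by continuity. Its interior is \<open>{\<Psi> < 1}\<close>: a point
  with \<open>\<Psi> = 1\<close> can be pushed outwards along its own ray by an arbitrarily small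
  amount, and homogeneity then lifts the value above 1.\<close>

lemma frontier_of_region: "top_of_set (span N) frontier_of region N \<Psi> 1 = {v \<in> span N. \<Psi> v = 1}"
proof -
  let ?X = "top_of_set (span N)" and ?I = "span N \<inter> \<Psi> -` {..<1}"
  have R: "region N \<Psi> 1 = span N \<inter> \<Psi> -` {..1}" unfolding region_def by auto
  have "closedin ?X (region N \<Psi> 1)"
    unfolding R by (intro continuous_closedin_preimage support_continuous) auto
  then have "?X closure_of region N \<Psi> 1 = region N \<Psi> 1" by (simp add: closure_of_eq)
  moreover have "?X interior_of region N \<Psi> 1 = ?I"
  proof (rule interior_of_unique)
    show "?I \<subseteq> region N \<Psi> 1" unfolding R by auto
    show "openin ?X ?I" by (intro continuous_openin_preimage_gen support_continuous) auto
    fix T assume T: "T \<subseteq> region N \<Psi> 1" "openin ?X T"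
    show "T \<subseteq> ?I"
    proof
      fix x assume x: "x \<in> T"
      then have xV: "x \<in> span N" "\<Psi> x \<le> 1" using T(1) unfolding R by auto
      obtain e where e: "e > 0" "ball x e \<inter> span N \<subseteq> T"
        using T(2) x unfolding openin_contains_ball by blast
      \<comment> \<open>Moving from \<open>x\<close> to \<open>(1 + r) *\<^sub>R x\<close> covers a
        distance of at most \<open>e / 2\<close>; the added 1 keeps the denominator positive when
        \<open>x = 0\<close>.\<close>
      define r where "r = e / (2 * (norm x + 1))"
      have r: "r > 0" using e(1) unfolding r_def by (simp add: add_nonneg_pos)
      have "r * norm x \<le> r * (norm x + 1)" using r by simp
      also have "\<dots> = e / 2" unfolding r_def by (simp add: field_simps add_nonneg_eq_0_iff)
      finally have "dist x ((1 + r) *\<^sub>R x) < e"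
        using r e(1) by (simp add: dist_norm scaleR_add_left)
      then have "(1 + r) *\<^sub>R x \<in> T" using e(2) span_scale[OF xV(1)] by auto
      then have "\<Psi> ((1 + r) *\<^sub>R x) \<le> 1" using T(1) unfolding R by auto
      then have "(1 + r) * \<Psi> x \<le> 1" using support_scaleR[OF xV(1), of "1 + r"] r by simp
      then have "\<Psi> x \<noteq> 1" using r by auto
      then show "x \<in> ?I" using xV by auto
    qed
  qed
  ultimately show ?thesis unfolding frontier_of_def R by auto
qed

end

section \<open>Lattice points in simplicial cones\<close>

definition gen_series :: "('a \<Rightarrow> real) \<Rightarrow> 'a set \<Rightarrow> int fps" where
  "gen_series \<Psi> A = Abs_fps (\<lambda>m. int (card {x \<in> A. \<Psi> x = real m}))"

text \<open>The finiteness of the fibres matters because \<open>card\<close> sends infinite sets to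
  0, so that additivity could fail.\<close>

lemma gen_series_UN:
  assumes "finite I" "disjoint_family_on A I"
    and fin: "\<And>i m. i \<in> I \<Longrightarrow> finite {x \<in> A i. \<Psi> x = real m}"
  shows "gen_series \<Psi> (\<Union>i\<in>I. A i) = (\<Sum>i\<in>I. gen_series \<Psi> (A i))"
proof (rule fps_ext)
  fix m
  have "{x \<in> (\<Union>i\<in>I. A i). \<Psi> x = real m} = (\<Union>i\<in>I. {x \<in> A i. \<Psi> x = real m})" by auto
  moreover have "card (\<Union>i\<in>I. {x \<in> A i. \<Psi> x = real m}) = (\<Sum>i\<in>I. card {x \<in> A i. \<Psi> x = real m})"
    using assms(2) unfolding disjoint_family_on_def
    by (intro card_UN_disjoint assms(1) ballI fin) blast+
  ultimately show "gen_series \<Psi> (\<Union>i\<in>I. A i) $ m = (\<Sum>i\<in>I. gen_series \<Psi> (A i)) $ m"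
    unfolding gen_series_def by (simp add: fps_sum_nth)
qed

lemma gen_series_Un:
  assumes "A \<inter> B = {}" "\<And>m. finite {x \<in> A. \<Psi> x = real m}" "\<And>m. finite {x \<in> B. \<Psi> x = real m}"
  shows "gen_series \<Psi> (A \<union> B) = gen_series \<Psi> A + gen_series \<Psi> B"
proof (rule fps_ext)
  fix m
  have "{x \<in> A \<union> B. \<Psi> x = real m} = {x \<in> A. \<Psi> x = real m} \<union> {x \<in> B. \<Psi> x = real m}" by auto
  moreover have "card ({x \<in> A. \<Psi> x = real m} \<union> {x \<in> B. \<Psi> x = real m})
      = card {x \<in> A. \<Psi> x = real m} + card {x \<in> B. \<Psi> x = real m}"
    using assms(1) by (intro card_Un_disjoint assms(2,3)) blast
  ultimately show "gen_series \<Psi> (A \<union> B) $ m = (gen_series \<Psi> A + gen_series \<Psi> B) $ m"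
    unfolding gen_series_def by simp
qed

text \<open>Nonnegativity excludes points of \<open>A\<close> that the series does not see but whose
  translates would land in degrees below \<open>k\<close>.\<close>

lemma gen_series_translate:
  fixes v :: "'a::ab_group_add"
  assumes shift: "\<And>x. x \<in> A \<Longrightarrow> \<Psi> (v + x) = \<Psi> x + real k" and nonneg: "\<And>x. x \<in> A \<Longrightarrow> \<Psi> x \<ge> 0"
  shows "gen_series \<Psi> ((+) v ` A) = fps_X ^ k * gen_series \<Psi> A"
proof (rule fps_ext)
  fix m
  have eq: "{y \<in> (+) v ` A. \<Psi> y = real m} = (+) v ` {x \<in> A. \<Psi> x + real k = real m}"
    using shift by auto
  show "gen_series \<Psi> ((+) v ` A) $ m = (fps_X ^ k * gen_series \<Psi> A) $ m"
  proof (cases "m < k")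
    case True
    then have "{y \<in> (+) v ` A. \<Psi> y = real m} = {}" using nonneg unfolding eq by force
    then have "card {y \<in> (+) v ` A. \<Psi> y = real m} = 0" by (simp only: card.empty)
    then show ?thesis using True by (simp add: gen_series_def fps_X_power_mult_nth)
  next
    case False
    then have "{x \<in> A. \<Psi> x + real k = real m} = {x \<in> A. \<Psi> x = real (m - k)}" by (auto simp: of_nat_diff)
    then show ?thesis using False eq by (simp add: gen_series_def fps_X_power_mult_nth card_image)
  qed
qed

lemma gen_series_finite:
  assumes "finite A" "\<And>x. x \<in> A \<Longrightarrow> \<Psi> x \<in> \<int>" "\<And>x. x \<in> A \<Longrightarrow> \<Psi> x \<ge> 0"
  shows "gen_series \<Psi> A = (\<Sum>x\<in>A. fps_X ^ nat \<lfloor>\<Psi> x\<rfloor>)"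
proof (rule fps_ext)
  fix m
  \<comment> \<open>The values are nonnegative integers, so rounding down and converting to a
    natural number loses nothing.\<close>
  have eq: "\<Psi> x = real m \<longleftrightarrow> m = nat \<lfloor>\<Psi> x\<rfloor>" if "x \<in> A" for x
    using assms(2,3)[OF that] by (auto elim!: Ints_cases)
  have "(\<Sum>x\<in>A. fps_X ^ nat \<lfloor>\<Psi> x\<rfloor>) $ m = (\<Sum>x\<in>A. if m = nat \<lfloor>\<Psi> x\<rfloor> then 1 else 0 :: int)"
    by (simp add: fps_sum_nth)
  also have "\<dots> = (\<Sum>x\<in>A. if \<Psi> x = real m then 1 else 0 :: int)"
    by (intro sum.cong) (simp_all add: eq)
  also have "\<dots> = int (card {x \<in> A. \<Psi> x = real m})"
    using assms(1) by (simp add: sum.If_cases Int_def)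
  finally show "gen_series \<Psi> A $ m = (\<Sum>x\<in>A. fps_X ^ nat \<lfloor>\<Psi> x\<rfloor>) $ m"
    by (simp add: gen_series_def)
qed

section \<open>Boxes, open cones and the half-open sets between them\<close>

definition open_box :: "'a::real_vector set \<Rightarrow> 'a set" where
  "open_box S = {(\<Sum>v\<in>S. a v *\<^sub>R v) | a. \<forall>v\<in>S. 0 < a v \<and> a v < 1}"

definition open_cone :: "'a::real_vector set \<Rightarrow> 'a set" where
  "open_cone S = {(\<Sum>v\<in>S. a v *\<^sub>R v) | a. \<forall>v\<in>S. 0 < a v}"

definition half_open :: "'a::real_vector set \<Rightarrow> 'a set \<Rightarrow> 'a set" where
  "half_open S U = {(\<Sum>v\<in>S. a v *\<^sub>R v) | a. (\<forall>v\<in>S. 0 < a v) \<and> (\<forall>v\<in>S - U. a v \<le> 1)}"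

lemma open_cone_eq_half_open: "open_cone S = half_open S S"
  unfolding open_cone_def half_open_def by simp

text \<open>Hence the origin is the only box point of the empty face, and this face contributes the
  h-polynomial of the whole complex.\<close>

lemma open_box_empty [simp]: "open_box {} = {0}"
  unfolding open_box_def by simp

lemma independent_sum_eqD:
  fixes S :: "'a::real_vector set"
  assumes "independent S" "finite S" "(\<Sum>v\<in>S. a v *\<^sub>R v) = (\<Sum>v\<in>S. b v *\<^sub>R v)" "v \<in> S"
  shows "a v = b v"
proof -
  have "(\<Sum>v\<in>S. (a v - b v) *\<^sub>R v) = 0"
    using assms(3) by (simp add: scaleR_diff_left sum_subtractf)
  then show ?thesis using independentD[OF assms(1,2) subset_refl _ assms(4)] by fastforce
qed

lemma sum_scaleR_update:
  fixes S :: "'a::real_vector set"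
  assumes "finite S" "v \<in> S"
  shows "(\<Sum>w\<in>S. (a(v := a v + c)) w *\<^sub>R w) = c *\<^sub>R v + (\<Sum>w\<in>S. a w *\<^sub>R w)"
  using assms by (simp add: sum.remove[of S v] scaleR_add_left)

lemma sum_scaleR_extend:
  fixes S :: "'a::real_vector set"
  assumes "finite S" "T \<subseteq> S"
  shows "(\<Sum>v\<in>T. a v *\<^sub>R v) = (\<Sum>v\<in>S. (if v \<in> T then a v else 0) *\<^sub>R v)"
  using assms by (intro sum.mono_neutral_cong_left) auto

text \<open>A single simplicial cone is studied here. The function enters through additivity on
  nonnegative combinations of \<open>S\<close> and integrality on \<open>N\<close>; for a face of
  the triangulation, additivity is supplied by \<open>support_sum\<close>.\<close>

context
  fixes N :: "'a::euclidean_space set" and \<Psi> :: "'a \<Rightarrow> real" and S :: "'a set" and d :: nat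
  assumes lattice: "is_lattice d N"
    and finite_S: "finite S" and indep: "independent S" and S_N: "S \<subseteq> N"
    and ints: "\<And>x. x \<in> N \<Longrightarrow> \<Psi> x \<in> \<int>"
    and additive: "\<And>a. \<forall>v\<in>S. 0 \<le> a v \<Longrightarrow> \<Psi> (\<Sum>v\<in>S. a v *\<^sub>R v) = (\<Sum>v\<in>S. a v)"
begin

text \<open>On level \<open>m\<close> the positive coefficients add up to \<open>m\<close>, so each
  is at most \<open>m\<close> and the fibre is bounded.\<close>

lemma finite_cone_fibre: "finite {x \<in> N \<inter> half_open S U. \<Psi> x = real m}"
proof -
  have "norm x \<le> real m * (\<Sum>v\<in>S. norm v)" if x: "x \<in> half_open S U" "\<Psi> x = real m" for x
  proof -
    obtain a where a: "x = (\<Sum>v\<in>S. a v *\<^sub>R v)" "\<forall>v\<in>S. 0 < a v"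
      using x(1) unfolding half_open_def by blast
    have nonneg: "\<forall>v\<in>S. 0 \<le> a v" using a(2) by (auto simp: less_imp_le)
    have m: "(\<Sum>v\<in>S. a v) = real m" using additive[OF nonneg] x(2) unfolding a(1) by simp
    have "norm x \<le> (\<Sum>v\<in>S. norm (a v *\<^sub>R v))" unfolding a(1) by (rule norm_sum)
    also have "\<dots> \<le> (\<Sum>v\<in>S. real m * norm v)"
    proof (rule sum_mono)
      fix v assume v: "v \<in> S"
      have "a v \<le> (\<Sum>v\<in>S. a v)" using nonneg finite_S by (intro member_le_sum v) auto
      then show "norm (a v *\<^sub>R v) \<le> real m * norm v"
        using nonneg v m by (simp add: mult_right_mono)
    qed
    finally show ?thesis by (simp add: sum_distrib_left)
  qed
  then have "{x \<in> N \<inter> half_open S U. \<Psi> x = real m} \<subseteq> N \<inter> cball 0 (real m * (\<Sum>v\<in>S. norm v))"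
    by auto
  then show ?thesis using finite_lattice_bounded[OF lattice bounded_cball] by (rule finite_subset)
qed

lemma half_open_nonneg: "x \<in> half_open S U \<Longrightarrow> \<Psi> x \<ge> 0"
  unfolding half_open_def by (auto simp: additive less_imp_le sum_nonneg)

lemma half_open_translate:
  assumes x: "x \<in> half_open S U" and v: "v \<in> S"
  shows "\<Psi> (v + x) = \<Psi> x + 1"
proof -
  obtain a where a: "x = (\<Sum>v\<in>S. a v *\<^sub>R v)" "\<forall>v\<in>S. 0 < a v"
    using x unfolding half_open_def by blast
  have "\<Psi> (\<Sum>w\<in>S. (a(v := a v + 1)) w *\<^sub>R w) = (\<Sum>w\<in>S. (a(v := a v + 1)) w)"
    using a(2) v by (intro additive) (auto simp: less_imp_le add_pos_pos)
  also have "\<dots> = (\<Sum>w\<in>S. a w) + 1"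
    using v finite_S by (simp add: sum.remove[of S v])
  also have "(\<Sum>w\<in>S. a w) = \<Psi> x" using a by (simp add: additive less_imp_le)
  finally show ?thesis
    unfolding sum_scaleR_update[OF finite_S v] by (simp add: a(1))
qed

text \<open>Split by the coefficient at \<open>v\<close>. If it exceeds 1, subtracting the lattice
  vector \<open>v\<close> keeps it positive and stays in \<open>N\<close>; if not, the point already
  belongs to the set for \<open>U\<close>. Uniqueness of coordinates makes the two cases
  exclusive.\<close>

lemma half_open_insert:
  assumes v: "v \<in> S" "v \<notin> U"
  shows "N \<inter> half_open S (insert v U) = (N \<inter> half_open S U) \<union> (+) v ` (N \<inter> half_open S (insert v U))"
    and "(N \<inter> half_open S U) \<inter> (+) v ` (N \<inter> half_open S (insert v U)) = {}"
proof -
  have vN: "v \<in> N" using v(1) S_N by blast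
  show "N \<inter> half_open S (insert v U) = (N \<inter> half_open S U) \<union> (+) v ` (N \<inter> half_open S (insert v U))"
  proof (intro equalityI subsetI)
    fix x assume x: "x \<in> N \<inter> half_open S (insert v U)"
    then obtain a where a: "x = (\<Sum>v\<in>S. a v *\<^sub>R v)" "\<forall>w\<in>S. 0 < a w" "\<forall>w\<in>S - insert v U. a w \<le> 1"
      unfolding half_open_def by blast
    show "x \<in> (N \<inter> half_open S U) \<union> (+) v ` (N \<inter> half_open S (insert v U))"
    proof (cases "a v \<le> 1")
      case True
      then have "\<forall>w\<in>S - U. a w \<le> 1" using a(3) by auto
      then have "x \<in> half_open S U" using a(1,2) unfolding half_open_def by blast
      then show ?thesis using x by blast
    next
      case False
      let ?b = "a(v := a v + (- 1))"
      have xv: "x - v = (\<Sum>w\<in>S. ?b w *\<^sub>R w)"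
        unfolding sum_scaleR_update[OF finite_S v(1)] a(1) by simp
      have "\<forall>w\<in>S. 0 < ?b w" "\<forall>w\<in>S - insert v U. ?b w \<le> 1" using a(2,3) False by auto
      then have "x - v \<in> half_open S (insert v U)" unfolding xv half_open_def by blast
      moreover have "x - v \<in> N" using x vN is_lattice_diff[OF lattice] by blast
      ultimately show ?thesis by (intro UnI2 image_eqI[of _ _ "x - v"]) auto
    qed
  next
    fix x assume "x \<in> (N \<inter> half_open S U) \<union> (+) v ` (N \<inter> half_open S (insert v U))"
    then show "x \<in> N \<inter> half_open S (insert v U)"
    proof
      assume "x \<in> N \<inter> half_open S U"
      then show ?thesis unfolding half_open_def by blast
    next
      assume "x \<in> (+) v ` (N \<inter> half_open S (insert v U))"
      then obtain y where y: "x = v + y" "y \<in> N" "y \<in> half_open S (insert v U)" by blast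
      then obtain a where a: "y = (\<Sum>v\<in>S. a v *\<^sub>R v)" "\<forall>w\<in>S. 0 < a w" "\<forall>w\<in>S - insert v U. a w \<le> 1"
        unfolding half_open_def by blast
      let ?b = "a(v := a v + 1)"
      have x: "x = (\<Sum>w\<in>S. ?b w *\<^sub>R w)"
        unfolding sum_scaleR_update[OF finite_S v(1)] y(1) a(1) by simp
      have "\<forall>w\<in>S. 0 < ?b w" "\<forall>w\<in>S - insert v U. ?b w \<le> 1" using a(2,3) by (auto simp: add_pos_pos)
      then have "x \<in> half_open S (insert v U)" unfolding x half_open_def by blast
      moreover have "x \<in> N" using y vN is_lattice_add[OF lattice] by blast
      ultimately show ?thesis by blast
    qed
  qed
  have False if xU: "x \<in> half_open S U" and yU: "y \<in> half_open S (insert v U)" and x: "x = v + y" for x y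
  proof -
    obtain a where a: "x = (\<Sum>v\<in>S. a v *\<^sub>R v)" "\<forall>w\<in>S - U. a w \<le> 1"
      using xU unfolding half_open_def by blast
    obtain b where b: "y = (\<Sum>v\<in>S. b v *\<^sub>R v)" "\<forall>w\<in>S. 0 < b w"
      using yU unfolding half_open_def by blast
    have "(\<Sum>w\<in>S. a w *\<^sub>R w) = (\<Sum>w\<in>S. (b(v := b v + 1)) w *\<^sub>R w)"
      unfolding sum_scaleR_update[OF finite_S v(1)] using x a(1) b(1) by simp
    then have "a v = b v + 1" using independent_sum_eqD[OF indep finite_S _ v(1), of a "b(v := b v + 1)"] by simp
    moreover have "a v \<le> 1" "0 < b v" using a(2) b(2) v by auto
    ultimately show False by simp
  qed
  then show "(N \<inter> half_open S U) \<inter> (+) v ` (N \<inter> half_open S (insert v U)) = {}" by blast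
qed

text \<open>
  Here \<open>half_open S U\<close> interpolates between the box with coefficients in \<open>(0, 1]\<close> for \<open>U = {}\<close> and the
  open cone for \<open>U = S\<close>; by \<open>half_open_insert\<close>, adding a vertex to \<open>U\<close> divides the series by \<open>1 - t\<close>.
\<close>

lemma gen_series_half_open:
  assumes "U \<subseteq> S"
  shows "gen_series \<Psi> (N \<inter> half_open S U) * (1 - fps_X) ^ card U = gen_series \<Psi> (N \<inter> half_open S {})"
  using finite_subset[OF assms finite_S] assms
proof (induction U rule: finite_induct)
  case empty
  then show ?case by simp
next
  case (insert v U)
  have v: "v \<in> S" "v \<notin> U" using insert by auto
  let ?g = "\<lambda>U. gen_series \<Psi> (N \<inter> half_open S U)"
  let ?tr = "(+) v ` (N \<inter> half_open S (insert v U))"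
  have tr: "gen_series \<Psi> ?tr = fps_X ^ 1 * ?g (insert v U)"
    using half_open_translate[OF _ v(1)] half_open_nonneg by (intro gen_series_translate) auto
  have "{x \<in> ?tr. \<Psi> x = real m} \<subseteq> {x \<in> N \<inter> half_open S (insert v U). \<Psi> x = real m}" for m
    using half_open_insert(1)[OF v] by blast
  then have fin: "finite {x \<in> ?tr. \<Psi> x = real m}" for m
    using finite_cone_fibre finite_subset by blast
  have "?g (insert v U) = gen_series \<Psi> ((N \<inter> half_open S U) \<union> ?tr)"
    using half_open_insert(1)[OF v] by simp
  also have "\<dots> = ?g U + gen_series \<Psi> ?tr"
    by (intro gen_series_Un half_open_insert(2)[OF v] finite_cone_fibre fin)
  finally have step: "?g (insert v U) * (1 - fps_X) = ?g U"
    unfolding tr by (simp add: algebra_simps)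
  have "?g (insert v U) * (1 - fps_X) ^ card (insert v U) = ?g (insert v U) * (1 - fps_X) * (1 - fps_X) ^ card U"
    using insert.hyps by (simp add: mult.assoc)
  then show ?case unfolding step using insert.IH insert.prems by (simp only: insert_subset)
qed

lemma finite_open_box:
  assumes "T \<subseteq> S"
  shows "finite (open_box T \<inter> N)"
proof -
  have "norm x \<le> (\<Sum>v\<in>T. norm v)" if x: "x \<in> open_box T" for x
  proof -
    obtain a where a: "x = (\<Sum>v\<in>T. a v *\<^sub>R v)" "\<forall>v\<in>T. 0 < a v \<and> a v < 1"
      using x unfolding open_box_def by blast
    have "norm x \<le> (\<Sum>v\<in>T. norm (a v *\<^sub>R v))" unfolding a(1) by (rule norm_sum)
    also have "\<dots> \<le> (\<Sum>v\<in>T. norm v)"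
      using a(2) by (intro sum_mono) (auto intro!: mult_left_le_one_le)
    finally show ?thesis .
  qed
  then have "open_box T \<inter> N \<subseteq> N \<inter> cball 0 (\<Sum>v\<in>T. norm v)" by auto
  then show ?thesis using finite_lattice_bounded[OF lattice bounded_cball] by (rule finite_subset)
qed

text \<open>The translated point has the coefficients of \<open>w\<close> on \<open>T\<close> and 1
  on \<open>S - T\<close>, so additivity applies. The upper bound later controls the degree of the
  box polynomial.\<close>

lemma open_box_support:
  assumes T: "T \<subseteq> S" and w: "w \<in> open_box T"
  shows "\<Psi> (\<Sum>(S - T) + w) = \<Psi> w + real (card (S - T))" "0 \<le> \<Psi> w" "\<Psi> w \<le> real (card T)"
proof -
  obtain a where a: "w = (\<Sum>v\<in>T. a v *\<^sub>R v)" "\<forall>v\<in>T. 0 < a v \<and> a v < 1"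
    using w unfolding open_box_def by blast
  have fT: "finite T" using T finite_S by (rule finite_subset)
  have "\<Psi> w = (\<Sum>v\<in>S. if v \<in> T then a v else 0)"
    unfolding a(1) sum_scaleR_extend[OF finite_S T] using a(2) by (intro additive) (auto simp: less_imp_le)
  then have \<Psi>w: "\<Psi> w = (\<Sum>v\<in>T. a v)"
    using T finite_S by (simp add: sum.If_cases Int_absorb1)
  show "0 \<le> \<Psi> w" unfolding \<Psi>w using a(2) by (intro sum_nonneg) (auto simp: less_imp_le)
  show "\<Psi> w \<le> real (card T)" unfolding \<Psi>w using sum_bounded_above[of T a 1] a(2) by (auto simp: less_imp_le)
  have split: "(\<Sum>v\<in>S. f v) = (\<Sum>v\<in>S - T. f v) + (\<Sum>v\<in>T. f v)" for f :: "'a \<Rightarrow> 'b::comm_monoid_add"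
    using sum.subset_diff[OF T finite_S] .
  have "\<Sum>(S - T) + w = (\<Sum>v\<in>S. (if v \<in> T then a v else 1) *\<^sub>R v)"
    unfolding split a(1) by (intro arg_cong2[of _ _ _ _ "(+)"] sum.cong) auto
  moreover have "\<Psi> (\<Sum>v\<in>S. (if v \<in> T then a v else 1) *\<^sub>R v) = (\<Sum>v\<in>S. if v \<in> T then a v else 1)"
    using a(2) by (intro additive) (auto simp: less_imp_le)
  moreover have "(\<Sum>v\<in>S. if v \<in> T then a v else 1) = real (card (S - T)) + \<Psi> w"
    unfolding split \<Psi>w by simp
  ultimately show "\<Psi> (\<Sum>(S - T) + w) = \<Psi> w + real (card (S - T))" by simp
qed

text \<open>With all coefficients in \<open>(0, 1]\<close>, let \<open>T\<close> collect the
  vertices whose coefficient is strictly below 1. The other coefficients equal 1, and removing those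
  vertices leaves a lattice point of the open box of \<open>T\<close>. As \<open>T\<close> can be
  read off from the coordinates, the pieces are disjoint.\<close>

lemma half_open_empty_decomposition:
  "N \<inter> half_open S {} = (\<Union>T\<in>Pow S. (+) (\<Sum>(S - T)) ` (open_box T \<inter> N))" (is ?eq)
  "disjoint_family_on (\<lambda>T. (+) (\<Sum>(S - T)) ` (open_box T \<inter> N)) (Pow S)" (is ?disj)
proof -
  have split: "(\<Sum>v\<in>S. f v) = (\<Sum>v\<in>S - T. f v) + (\<Sum>v\<in>T. f v)" if "T \<subseteq> S" for T and f :: "'a \<Rightarrow> 'a"
    using sum.subset_diff[OF that finite_S] .
  have sumN: "\<Sum>(S - T) \<in> N" for T
    using S_N by (intro is_lattice_sum[OF lattice]) auto
  show ?eq
  proof (intro equalityI subsetI)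
    fix x assume x: "x \<in> N \<inter> half_open S {}"
    then obtain a where a: "x = (\<Sum>v\<in>S. a v *\<^sub>R v)" "\<forall>v\<in>S. 0 < a v" "\<forall>v\<in>S. a v \<le> 1"
      unfolding half_open_def by auto
    define T where "T = {v \<in> S. a v < 1}"
    have T: "T \<subseteq> S" unfolding T_def by blast
    define w where "w = (\<Sum>v\<in>T. a v *\<^sub>R v)"
    have "(\<Sum>v\<in>S - T. a v *\<^sub>R v) = \<Sum>(S - T)"
      using a(3) unfolding T_def by (intro sum.cong) (auto simp: not_less dest: antisym)
    then have xw: "x = \<Sum>(S - T) + w" unfolding a(1) split[OF T] w_def by simp
    have "w \<in> open_box T"
      using a(2) unfolding open_box_def w_def T_def by blast
    moreover have "w = x - \<Sum>(S - T)" using xw by simp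
    then have "w \<in> N" using x sumN is_lattice_diff[OF lattice] by blast
    ultimately show "x \<in> (\<Union>T\<in>Pow S. (+) (\<Sum>(S - T)) ` (open_box T \<inter> N))"
      using T xw by blast
  next
    fix x assume "x \<in> (\<Union>T\<in>Pow S. (+) (\<Sum>(S - T)) ` (open_box T \<inter> N))"
    then obtain T w where T: "T \<subseteq> S" and w: "w \<in> open_box T" "w \<in> N" and x: "x = \<Sum>(S - T) + w" by blast
    obtain a where a: "w = (\<Sum>v\<in>T. a v *\<^sub>R v)" "\<forall>v\<in>T. 0 < a v \<and> a v < 1"
      using w(1) unfolding open_box_def by blast
    have "x = (\<Sum>v\<in>S. (if v \<in> T then a v else 1) *\<^sub>R v)"
      unfolding split[OF T] x a(1) by (intro arg_cong2[of _ _ _ _ "(+)"] sum.cong) auto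
    moreover have "\<forall>v\<in>S. 0 < (if v \<in> T then a v else 1)" "\<forall>v\<in>S - {}. (if v \<in> T then a v else 1) \<le> 1"
      using a(2) by (auto simp: less_imp_le)
    ultimately have "x \<in> half_open S {}"
      unfolding half_open_def by (intro CollectI exI[of _ "\<lambda>v. if v \<in> T then a v else 1"]) simp
    moreover have "x \<in> N" unfolding x using sumN w(2) by (rule is_lattice_add[OF lattice])
    ultimately show "x \<in> N \<inter> half_open S {}" by blast
  qed
  have key: "T = {v \<in> S. a v < 1}"
    if T: "T \<subseteq> S" and w: "w \<in> open_box T" and eq: "(\<Sum>v\<in>S. a v *\<^sub>R v) = \<Sum>(S - T) + w" for T w a
  proof -
    obtain b where b: "w = (\<Sum>v\<in>T. b v *\<^sub>R v)" "\<forall>v\<in>T. 0 < b v \<and> b v < 1"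
      using w unfolding open_box_def by blast
    have "\<Sum>(S - T) + w = (\<Sum>v\<in>S. (if v \<in> T then b v else 1) *\<^sub>R v)"
      unfolding split[OF T] b(1) by (intro arg_cong2[of _ _ _ _ "(+)"] sum.cong) auto
    then have coeff: "(\<Sum>v\<in>S. a v *\<^sub>R v) = (\<Sum>v\<in>S. (if v \<in> T then b v else 1) *\<^sub>R v)"
      using eq by simp
    have "a v = (if v \<in> T then b v else 1)" if v: "v \<in> S" for v
      by (rule independent_sum_eqD[OF indep finite_S coeff v])
    then show ?thesis using T b(2) by (auto split: if_splits)
  qed
  have ex: "\<exists>a. \<Sum>(S - T) + w = (\<Sum>v\<in>S. a v *\<^sub>R v)" if T: "T \<subseteq> S" and w: "w \<in> open_box T" for T w
  proof -
    obtain b where b: "w = (\<Sum>v\<in>T. b v *\<^sub>R v)" using w unfolding open_box_def by blast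
    have "\<Sum>(S - T) + w = (\<Sum>v\<in>S. (if v \<in> T then b v else 1) *\<^sub>R v)"
      unfolding split[OF T] b(1) by (intro arg_cong2[of _ _ _ _ "(+)"] sum.cong) auto
    then show ?thesis by (rule exI[of _ "\<lambda>v. if v \<in> T then b v else 1"])
  qed
  have "T = T'"
    if T: "T \<subseteq> S" "w \<in> open_box T" and T': "T' \<subseteq> S" "w' \<in> open_box T'"
      and eq: "\<Sum>(S - T) + w = \<Sum>(S - T') + w'" for T T' w w'
  proof -
    \<comment> \<open>One coefficient function for the common point serves both representations, and
      \<open>key\<close> recovers \<open>T\<close> and \<open>T'\<close> from it.\<close>
    obtain a where a: "\<Sum>(S - T) + w = (\<Sum>v\<in>S. a v *\<^sub>R v)" using ex[OF T] by blast
    have "T = {v \<in> S. a v < 1}" by (rule key[OF T a[symmetric]])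
    moreover have "T' = {v \<in> S. a v < 1}" by (rule key[OF T' trans[OF a[symmetric] eq]])
    ultimately show ?thesis by simp
  qed
  then show ?disj unfolding disjoint_family_on_def by blast
qed

lemma gen_series_open_cone:
  "gen_series \<Psi> (N \<inter> open_cone S) * (1 - fps_X) ^ card S =
     (\<Sum>T\<in>Pow S. fps_X ^ card (S - T) * (\<Sum>w\<in>open_box T \<inter> N. fps_X ^ nat \<lfloor>\<Psi> w\<rfloor>))"
proof -
  have "gen_series \<Psi> (N \<inter> open_cone S) * (1 - fps_X) ^ card S = gen_series \<Psi> (N \<inter> half_open S {})"
    using gen_series_half_open[of S] by (simp add: open_cone_eq_half_open)
  also have "\<dots> = (\<Sum>T\<in>Pow S. gen_series \<Psi> ((+) (\<Sum>(S - T)) ` (open_box T \<inter> N)))"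
    unfolding half_open_empty_decomposition(1)
    using finite_S finite_open_box by (intro gen_series_UN half_open_empty_decomposition(2)) auto
  also have "\<dots> = (\<Sum>T\<in>Pow S. fps_X ^ card (S - T) * (\<Sum>w\<in>open_box T \<inter> N. fps_X ^ nat \<lfloor>\<Psi> w\<rfloor>))"
  proof (rule sum.cong)
    fix T assume "T \<in> Pow S"
    then have T: "T \<subseteq> S" by simp
    have "gen_series \<Psi> ((+) (\<Sum>(S - T)) ` (open_box T \<inter> N))
        = fps_X ^ card (S - T) * gen_series \<Psi> (open_box T \<inter> N)"
      using open_box_support[OF T] by (intro gen_series_translate) auto
    also have "gen_series \<Psi> (open_box T \<inter> N) = (\<Sum>w\<in>open_box T \<inter> N. fps_X ^ nat \<lfloor>\<Psi> w\<rfloor>)"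
      using open_box_support[OF T] ints by (intro gen_series_finite finite_open_box T) auto
    finally show "gen_series \<Psi> ((+) (\<Sum>(S - T)) ` (open_box T \<inter> N))
        = fps_X ^ card (S - T) * (\<Sum>w\<in>open_box T \<inter> N. fps_X ^ nat \<lfloor>\<Psi> w\<rfloor>)" .
  qed simp
  finally show ?thesis .
qed

end

section \<open>Triangulations of the boundary\<close>

text \<open>From the fan only homogeneity, positivity and integrality of \<open>\<Psi>\<close> are
  retained, so faces of \<open>\<T>\<close> never have to be compared with cones of
  \<open>\<Sigma>\<close>.\<close>

locale lattice_triangulation =
  fixes N :: "'a::euclidean_space set" and \<Psi> :: "'a \<Rightarrow> real" and d :: nat and \<T> :: "'a set set"
  assumes lattice: "is_lattice d N"
    and scale: "\<And>x c. x \<in> span N \<Longrightarrow> 0 \<le> c \<Longrightarrow> \<Psi> (c *\<^sub>R x) = c * \<Psi> x"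
    and pos: "\<And>x. x \<in> span N \<Longrightarrow> x \<noteq> 0 \<Longrightarrow> \<Psi> x > 0"
    and ints: "\<And>x. x \<in> N \<Longrightarrow> \<Psi> x \<in> \<int>"
    and complex: "simplicial_complex \<T>"
    and empty_face: "{} \<in> \<T>"
    and vertex: "\<And>v. {v} \<in> \<T> \<Longrightarrow> v \<in> N"
    and union: "\<Union>\<T> = {v \<in> span N. \<Psi> v = 1}"
begin

lemma finite_faces: "finite \<T>"
  using complex unfolding simplicial_complex_def by blast

lemma support_zero: "\<Psi> 0 = 0"
  using scale[of 0 0, OF span_zero] by simp

lemma face_vertices:
  assumes "F \<in> \<T>"
  shows "\<not> affine_dependent (vertices F)" "finite (vertices F)" "F = convex hull (vertices F)"
proof -
  obtain n where "n simplex F" using assms complex unfolding simplicial_complex_def by blast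
  then obtain C where C: "\<not> affine_dependent C" "F = convex hull C" unfolding simplex_def by blast
  have "vertices F = C"
    unfolding vertices_def C(2) using extreme_point_of_convex_hull_affine_independent[OF C(1)] by blast
  then show "\<not> affine_dependent (vertices F)" "finite (vertices F)" "F = convex hull (vertices F)"
    using C aff_independent_finite by auto
qed

lemma vertices_empty: "vertices {} = {}"
  unfolding vertices_def by (simp add: extreme_point_of_def)

lemma vertices_eq_empty_iff: "F \<in> \<T> \<Longrightarrow> vertices F = {} \<longleftrightarrow> F = {}"
  using face_vertices(3) vertices_empty by fastforce

lemma subface:
  assumes "F \<in> \<T>" "S \<subseteq> vertices F"
  shows "convex hull S \<in> \<T>" "vertices (convex hull S) = S"
proof -
  have "convex hull S face_of F"
    using face_of_convex_hull_affine_independent[OF face_vertices(1)[OF assms(1)]] assms(2)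
      face_vertices(3)[OF assms(1)] by metis
  then show "convex hull S \<in> \<T>" using assms(1) complex unfolding simplicial_complex_def by blast
  have "\<not> affine_dependent S" using face_vertices(1)[OF assms(1)] assms(2) by (rule affine_independent_subset)
  then show "vertices (convex hull S) = S"
    unfolding vertices_def using extreme_point_of_convex_hull_affine_independent by blast
qed

lemma vertices_subset_lattice:
  assumes "F \<in> \<T>"
  shows "vertices F \<subseteq> N"
proof
  fix v assume "v \<in> vertices F"
  then have "convex hull {v} \<in> \<T>" using subface(1)[OF assms, of "{v}"] by blast
  then show "v \<in> N" by (intro vertex) simp
qed

lemma face_point:
  assumes "F \<in> \<T>" "x \<in> F"
  shows "x \<in> span N" "\<Psi> x = 1" "x \<noteq> 0"
proof -
  have "x \<in> \<Union>\<T>" using assms by blast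
  then show "x \<in> span N" "\<Psi> x = 1" unfolding union by auto
  then show "x \<noteq> 0" using support_zero by auto
qed

text \<open>
  If the vertices were linearly dependent, the origin would lie in the affine hull of the simplex,
  and the simplex would contain a multiple \<open>(1 + e) x\<close> of its barycenter \<open>x\<close> with \<open>e > 0\<close>,
  where \<open>\<Psi>\<close> exceeds \<open>1\<close>.
\<close>

lemma independent_vertices:
  assumes F: "F \<in> \<T>"
  shows "independent (vertices F)"
proof
  let ?S = "vertices F"
  have fS: "finite ?S" using face_vertices(2)[OF F] .
  assume "dependent ?S"
  then obtain u v where u: "v \<in> ?S" "u v \<noteq> 0" "(\<Sum>w\<in>?S. u w *\<^sub>R w) = 0"
    using dependent_finite[OF fS] by blast
  \<comment> \<open>Affine independence keeps the coefficient sum of the relation nonzero; dividing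
    by it writes the origin as an affine combination of the vertices.\<close>
  have u0: "(\<Sum>w\<in>?S. u w) \<noteq> 0"
    using u face_vertices(1)[OF F] affine_dependent_explicit_finite[OF fS] by blast
  define r where "r = (\<lambda>w. u w / (\<Sum>w\<in>?S. u w))"
  have r1: "(\<Sum>w\<in>?S. r w) = 1" using u0 unfolding r_def by (simp flip: sum_divide_distrib)
  have "(\<Sum>w\<in>?S. r w *\<^sub>R w) = inverse (\<Sum>w\<in>?S. u w) *\<^sub>R (\<Sum>w\<in>?S. u w *\<^sub>R w)"
    unfolding r_def scaleR_sum_right by (simp add: field_simps)
  then have r0: "(\<Sum>w\<in>?S. r w *\<^sub>R w) = 0" using u(3) by simp
  define n where "n = real (card ?S)"
  have n: "n > 0" using u(1) fS unfolding n_def by (auto simp: card_gt_0_iff)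
  define K where "K = 1 + (\<Sum>w\<in>?S. \<bar>r w\<bar>)"
  have K: "K > 0" unfolding K_def by (simp add: add_pos_nonneg sum_nonneg)
  have rK: "r w \<le> K" if "w \<in> ?S" for w
  proof -
    have "\<bar>r w\<bar> \<le> (\<Sum>w\<in>?S. \<bar>r w\<bar>)" using fS that by (intro member_le_sum) auto
    then show ?thesis unfolding K_def by linarith
  qed
  \<comment> \<open>Since \<open>K\<close> bounds every \<open>r w\<close>, this \<open>e\<close>
    satisfies \<open>e * r w \<le> inverse n\<close>, so subtracting \<open>e\<close> times the
    combination for the origin from \<open>(1 + e) *\<^sub>R x\<close> leaves nonnegative
    coefficients with sum 1.\<close>
  define e where "e = inverse (n * K)"
  have e: "e > 0" using n K unfolding e_def by simp
  define x where "x = (\<Sum>w\<in>?S. inverse n *\<^sub>R w)"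
  have hull: "F = {y. \<exists>u. (\<forall>x\<in>?S. 0 \<le> u x) \<and> sum u ?S = 1 \<and> (\<Sum>x\<in>?S. u x *\<^sub>R x) = y}"
    using face_vertices(3)[OF F] convex_hull_finite[OF fS] by metis
  have "(\<Sum>w\<in>?S. inverse n) = 1" using n unfolding n_def by simp
  then have xF: "x \<in> F" unfolding x_def using n
    by (subst hull) (auto intro!: exI[of _ "\<lambda>_. inverse n"])
  have "0 \<le> (1 + e) * inverse n - e * r w" if "w \<in> ?S" for w
  proof -
    have "e * r w \<le> e * K" using rK[OF that] e by simp
    also have "\<dots> = inverse n" using K unfolding e_def by simp
    also have "\<dots> \<le> (1 + e) * inverse n" using e n by simp
    finally show ?thesis by simp
  qed
  moreover have "(\<Sum>w\<in>?S. (1 + e) * inverse n - e * r w) = (1 + e) * (\<Sum>w\<in>?S. inverse n) - e * (\<Sum>w\<in>?S. r w)"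
    by (simp only: sum_subtractf sum_distrib_left)
  then have "(\<Sum>w\<in>?S. (1 + e) * inverse n - e * r w) = 1"
    using r1 \<open>(\<Sum>w\<in>?S. inverse n) = 1\<close> by simp
  moreover have "(\<Sum>w\<in>?S. ((1 + e) * inverse n - e * r w) *\<^sub>R w) = (1 + e) *\<^sub>R x - e *\<^sub>R (\<Sum>w\<in>?S. r w *\<^sub>R w)"
    unfolding x_def scaleR_sum_right by (simp add: scaleR_diff_left sum_subtractf)
  then have "(\<Sum>w\<in>?S. ((1 + e) * inverse n - e * r w) *\<^sub>R w) = (1 + e) *\<^sub>R x" using r0 by simp
  ultimately have "(1 + e) *\<^sub>R x \<in> F"
    by (subst hull) (intro CollectI exI[of _ "\<lambda>w. (1 + e) * inverse n - e * r w"], simp)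
  then have "\<Psi> ((1 + e) *\<^sub>R x) = 1" using face_point[OF F] by blast
  moreover have "\<Psi> ((1 + e) *\<^sub>R x) = 1 + e"
    using scale[OF face_point(1)[OF F xF], of "1 + e"] face_point(2)[OF F xF] e by simp
  ultimately show False using e by simp
qed

text \<open>Dividing by the total of the coefficients gives a convex combination, hence a point of
  \<open>F\<close>, where \<open>\<Psi>\<close> is 1; homogeneity restores the factor. A total of 0
  means that all coefficients vanish.\<close>

lemma support_sum:
  assumes F: "F \<in> \<T>" and a: "\<forall>v\<in>vertices F. 0 \<le> a v"
  shows "\<Psi> (\<Sum>v\<in>vertices F. a v *\<^sub>R v) = (\<Sum>v\<in>vertices F. a v)"
proof (cases "(\<Sum>v\<in>vertices F. a v) = 0")
  case True
  then have "\<forall>v\<in>vertices F. a v = 0" using a sum_nonneg_eq_0_iff face_vertices(2)[OF F] by blast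
  then show ?thesis by (simp add: support_zero)
next
  case False
  define s where "s = (\<Sum>v\<in>vertices F. a v)"
  define y where "y = (\<Sum>v\<in>vertices F. (a v / s) *\<^sub>R v)"
  have s: "s > 0" using False a unfolding s_def by (simp add: sum_nonneg order.not_eq_order_implies_strict)
  have "(\<Sum>v\<in>vertices F. a v / s) = 1" using s by (simp add: s_def flip: sum_divide_distrib)
  then have "y \<in> convex hull (vertices F)"
    unfolding convex_hull_finite[OF face_vertices(2)[OF F]] y_def using a s
    by (intro CollectI exI[of _ "\<lambda>v. a v / s"]) simp
  then have y: "y \<in> F" using face_vertices(3)[OF F] by simp
  have "(\<Sum>v\<in>vertices F. a v *\<^sub>R v) = s *\<^sub>R y" using s unfolding y_def scaleR_sum_right by simp
  then show ?thesis using scale[OF face_point(1)[OF F y], of s] face_point(2)[OF F y] s unfolding s_def by simp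
qed

section \<open>Cones over faces and the decomposition of the lattice\<close>

lemma cone_over_face:
  assumes "F \<in> \<T>"
  shows "convex_cone hull F = {(\<Sum>v\<in>vertices F. a v *\<^sub>R v) | a. \<forall>v\<in>vertices F. 0 \<le> a v}"
  using convex_cone_hull_finite[OF face_vertices(2)[OF assms]] convex_cone_hull_convex_hull_eq[of "vertices F"]
    face_vertices(3)[OF assms] by simp

lemma cone_point:
  assumes F: "F \<in> \<T>" and z: "z \<in> convex_cone hull F" "z \<noteq> 0"
  shows "inverse (\<Psi> z) *\<^sub>R z \<in> F"
proof -
  obtain a where a: "z = (\<Sum>v\<in>vertices F. a v *\<^sub>R v)" "\<forall>v\<in>vertices F. 0 \<le> a v"
    using z(1) unfolding cone_over_face[OF F] by blast
  have s: "\<Psi> z = (\<Sum>v\<in>vertices F. a v)" unfolding a(1) using support_sum[OF F a(2)] .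
  have "(\<Sum>v\<in>vertices F. a v) \<noteq> 0"
    using a sum_nonneg_eq_0_iff[OF face_vertices(2)[OF F], of a] z(2) by (auto intro: sum.neutral)
  then have p: "\<Psi> z > 0" using a(2) unfolding s by (simp add: sum_nonneg order.not_eq_order_implies_strict)
  have "(\<Sum>v\<in>vertices F. inverse (\<Psi> z) * a v) = 1" using p unfolding s by (simp flip: sum_distrib_left)
  moreover have "inverse (\<Psi> z) *\<^sub>R z = (\<Sum>v\<in>vertices F. (inverse (\<Psi> z) * a v) *\<^sub>R v)"
    unfolding a(1) by (simp add: scaleR_sum_right)
  ultimately have "inverse (\<Psi> z) *\<^sub>R z \<in> convex hull (vertices F)"
    unfolding convex_hull_finite[OF face_vertices(2)[OF F]] using a(2) p
    by (intro CollectI exI[of _ "\<lambda>v. inverse (\<Psi> z) * a v"]) simp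
  then show ?thesis using face_vertices(3)[OF F] by simp
qed

text \<open>Divided by \<open>\<Psi> z\<close>, the point \<open>z\<close> has positive barycentric
  coordinates in \<open>F\<close>, so it lies in the relative interior of \<open>F\<close>, and it
  also lies in \<open>G\<close>. The face \<open>F \<inter> G\<close> of \<open>F\<close> meets that
  relative interior and is therefore all of \<open>F\<close>.\<close>

lemma open_cone_imp_subset:
  assumes F: "F \<in> \<T>" and G: "G \<in> \<T>" and z: "z \<in> open_cone (vertices F)" "z \<in> convex_cone hull G"
  shows "F \<subseteq> G"
proof (cases "vertices F = {}")
  case True
  then show ?thesis using vertices_eq_empty_iff[OF F] by simp
next
  case False
  obtain a where a: "z = (\<Sum>v\<in>vertices F. a v *\<^sub>R v)" "\<forall>v\<in>vertices F. 0 < a v"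
    using z(1) unfolding open_cone_def by blast
  have s: "\<Psi> z = (\<Sum>v\<in>vertices F. a v)"
    unfolding a(1) using a(2) by (intro support_sum[OF F]) (simp add: less_imp_le)
  have p: "\<Psi> z > 0" unfolding s using a(2) by (intro sum_pos face_vertices(2)[OF F] False) auto
  then have "z \<noteq> 0" using support_zero by auto
  have sum1: "(\<Sum>v\<in>vertices F. inverse (\<Psi> z) * a v) = 1" using p unfolding s by (simp flip: sum_distrib_left)
  have y: "inverse (\<Psi> z) *\<^sub>R z = (\<Sum>v\<in>vertices F. (inverse (\<Psi> z) * a v) *\<^sub>R v)"
    unfolding a(1) by (simp add: scaleR_sum_right)
  have "inverse (\<Psi> z) *\<^sub>R z \<in> rel_interior (convex hull (vertices F))"
    unfolding rel_interior_convex_hull_explicit[OF face_vertices(1)[OF F]] using a(2) p y sum1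
    by (intro CollectI exI[of _ "\<lambda>v. inverse (\<Psi> z) * a v"]) simp
  then have "inverse (\<Psi> z) *\<^sub>R z \<in> rel_interior F" using face_vertices(3)[OF F] by simp
  moreover have "inverse (\<Psi> z) *\<^sub>R z \<in> G" using cone_point[OF G z(2) \<open>z \<noteq> 0\<close>] .
  moreover have "F \<inter> G face_of F" using complex F G unfolding simplicial_complex_def by blast
  ultimately have "F \<subseteq> F \<inter> G"
    using rel_interior_subset by (intro subset_of_face_of[of "F \<inter> G" F F]) auto
  then show ?thesis by blast
qed

lemma subset_iff_vertices:
  assumes F: "F \<in> \<T>" and G: "G \<in> \<T>"
  shows "F \<subseteq> G \<longleftrightarrow> vertices F \<subseteq> vertices G"
proof
  assume "F \<subseteq> G"
  moreover have "F \<inter> G face_of G"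
    using complex F G unfolding simplicial_complex_def by (metis Int_commute)
  ultimately have "F face_of G" by (simp add: Int_absorb2)
  then show "vertices F \<subseteq> vertices G" unfolding vertices_def by (auto simp: extreme_point_of_face)
next
  assume "vertices F \<subseteq> vertices G"
  then show "F \<subseteq> G" using face_vertices(3)[OF F] face_vertices(3)[OF G] hull_mono by metis
qed

lemma open_cone_subset_cone: "F \<in> \<T> \<Longrightarrow> open_cone (vertices F) \<subseteq> convex_cone hull F"
  unfolding cone_over_face open_cone_def using less_imp_le by blast

lemma in_open_cone:
  assumes x: "x \<in> span N"
  shows "\<exists>F\<in>\<T>. x \<in> open_cone (vertices F)"
proof (cases "x = 0")
  case True
  then have "x \<in> open_cone (vertices {})" unfolding vertices_empty open_cone_def by simp
  then show ?thesis using empty_face by blast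
next
  case False
  have p: "\<Psi> x > 0" using pos[OF x False] .
  define y where "y = inverse (\<Psi> x) *\<^sub>R x"
  have "y \<in> span N" "\<Psi> y = 1" using x p scale[OF x, of "inverse (\<Psi> x)"] unfolding y_def by (auto intro: span_scale)
  then have "y \<in> \<Union>\<T>" unfolding union by blast
  then obtain G where G: "G \<in> \<T>" "y \<in> G" by blast
  then have "y \<in> convex hull (vertices G)" using face_vertices(3)[OF G(1)] by simp
  then obtain u where u: "\<forall>v\<in>vertices G. 0 \<le> u v" "(\<Sum>v\<in>vertices G. u v *\<^sub>R v) = y"
    unfolding convex_hull_finite[OF face_vertices(2)[OF G(1)]] by blast
  \<comment> \<open>Dropping the vertices with coefficient 0 passes to the subface that carries
    \<open>y\<close> in its relative interior.\<close>
  define S where "S = {v \<in> vertices G. u v > 0}"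
  have S: "S \<subseteq> vertices G" unfolding S_def by blast
  have y: "y = (\<Sum>v\<in>S. u v *\<^sub>R v)"
    unfolding u(2)[symmetric] using u(1) face_vertices(2)[OF G(1)] S
    by (intro sum.mono_neutral_right) (auto simp: S_def)
  have "x = \<Psi> x *\<^sub>R y" using p unfolding y_def by simp
  then have "x = (\<Sum>v\<in>S. (\<Psi> x * u v) *\<^sub>R v)" by (simp add: y scaleR_sum_right)
  moreover have "\<forall>v\<in>S. 0 < \<Psi> x * u v" using p unfolding S_def by simp
  ultimately have "x \<in> open_cone S"
    unfolding open_cone_def by (intro CollectI exI[of _ "\<lambda>v. \<Psi> x * u v"] conjI)
  then show ?thesis using subface[OF G(1) S] by metis
qed

lemma open_cone_disjoint: "disjoint_family_on (\<lambda>F. N \<inter> open_cone (vertices F)) \<T>"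
proof -
  have "F = G" if "F \<in> \<T>" "G \<in> \<T>" "z \<in> open_cone (vertices F)" "z \<in> open_cone (vertices G)" for F G z
    using open_cone_imp_subset[of F G z] open_cone_imp_subset[of G F z] open_cone_subset_cone that by blast
  then show ?thesis unfolding disjoint_family_on_def by blast
qed

lemma lattice_decomposition: "N = (\<Union>F\<in>\<T>. N \<inter> open_cone (vertices F))"
  using in_open_cone span_base by blast

lemma card_vertices_le:
  assumes "F \<in> \<T>"
  shows "card (vertices F) \<le> d"
proof -
  have "vertices F \<subseteq> span N" using vertices_subset_lattice[OF assms] span_superset by blast
  then show ?thesis
    using independent_card_le_dim[OF _ independent_vertices[OF assms]] is_lattice_dim[OF lattice] by metis
qed

section \<open>Fans of links\<close>

lemma span_face: "F \<in> \<T> \<Longrightarrow> span F = span (vertices F)"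
  using face_vertices(3) span_convex_hull by metis

lemma dim_face:
  assumes "F \<in> \<T>"
  shows "dim F = card (vertices F)"
proof -
  have "dim F = dim (vertices F)" using span_face[OF assms] by (metis dim_span)
  then show ?thesis using independent_vertices[OF assms] by (simp add: dim_eq_card_independent)
qed

lemma span_convex_cone_hull: "span (convex_cone hull F) = span F"
proof (rule equalityI)
  have "convex_cone hull F \<subseteq> span F" using span_superset convex_cone_span by (rule hull_minimal)
  then show "span (convex_cone hull F) \<subseteq> span F" using subspace_span by (rule span_minimal)
  show "span F \<subseteq> span (convex_cone hull F)" by (intro span_mono hull_subset)
qed

text \<open>Points of \<open>F\<close> have \<open>\<Psi> = 1\<close>, so the radial scaling of
  \<open>cone_point\<close> leaves them fixed. This turns the selection of cones in
  \<open>link_fan\<close> into a selection of faces.\<close>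

lemma face_subset_cone_iff:
  assumes F: "F \<in> \<T>" and G: "G \<in> \<T>"
  shows "F \<subseteq> convex_cone hull G \<longleftrightarrow> F \<subseteq> G"
proof
  assume sub: "F \<subseteq> convex_cone hull G"
  show "F \<subseteq> G"
  proof
    fix x assume x: "x \<in> F"
    then show "x \<in> G" using cone_point[OF G, of x] sub face_point[OF F x] by auto
  qed
next
  assume "F \<subseteq> G"
  then show "F \<subseteq> convex_cone hull G" using hull_subset[of G convex_cone] by blast
qed

lemma project_mod_decomp:
  assumes "x \<in> \<sigma>"
  obtains y where "y \<in> project_mod F \<sigma>" "x - y \<in> span F"
proof -
  obtain f y where fy: "f \<in> span F" "\<And>w. w \<in> span F \<Longrightarrow> orthogonal y w" "x = f + y"
    using orthogonal_subspace_decomp_exists[of F x] by blast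
  have "y \<in> (span F)\<^sup>\<bottom>" using fy(2) unfolding orthogonal_comp_def by (simp add: orthogonal_commute)
  moreover have "x - y \<in> span F" using fy by simp
  ultimately show ?thesis using assms that unfolding project_mod_def by blast
qed

text \<open>The projected cone lies in the orthogonal complement of \<open>span F\<close> and
  together with \<open>span F\<close> spans \<open>span G\<close>; the sum is direct, so dimensions
  subtract.\<close>

lemma dim_project_mod:
  assumes F: "F \<in> \<T>" and G: "G \<in> \<T>" and FG: "F \<subseteq> G"
  shows "dim (project_mod F (convex_cone hull G)) = card (vertices G) - card (vertices F)"
proof -
  let ?A = "project_mod F (convex_cone hull G)"
  have sub: "span F \<subseteq> span G" using FG by (rule span_mono)
  have AG: "?A \<subseteq> span G"
  proof
    fix y assume "y \<in> ?A"
    then obtain x where x: "x \<in> convex_cone hull G" "x - y \<in> span F" unfolding project_mod_def by blast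
    have "x \<in> span G" using x(1) span_convex_cone_hull[of G] span_superset[of "convex_cone hull G"] by blast
    moreover have "x - y \<in> span G" using x(2) sub by blast
    ultimately have "x - (x - y) \<in> span G" by (rule span_diff)
    then show "y \<in> span G" by simp
  qed
  have perp: "span ?A \<subseteq> (span F)\<^sup>\<bottom>"
    by (rule span_minimal) (auto simp: project_mod_def subspace_orthogonal_comp)
  have "x = 0" if "x \<in> span F" "x \<in> span ?A" for x
  proof -
    have "orthogonal x x" using that perp unfolding orthogonal_comp_def by blast
    then show ?thesis by (simp add: orthogonal_self)
  qed
  then have int: "span F \<inter> span ?A = {0}" using span_zero[of F] span_zero[of ?A] by blast
  have "{x + y | x y. x \<in> span F \<and> y \<in> span ?A} = span G"
  proof (intro equalityI subsetI)
    fix z assume "z \<in> {x + y | x y. x \<in> span F \<and> y \<in> span ?A}"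
    then obtain x y where xy: "z = x + y" "x \<in> span F" "y \<in> span ?A" by blast
    have "span ?A \<subseteq> span G" using span_mono[OF AG] by (simp add: span_span)
    then have "x \<in> span G" "y \<in> span G" using xy(2,3) sub by blast+
    then show "z \<in> span G" unfolding xy(1) by (rule span_add)
  next
    have G': "G \<subseteq> {x + y | x y. x \<in> span F \<and> y \<in> span ?A}"
    proof
      fix x assume "x \<in> G"
      then have "x \<in> convex_cone hull G" by (rule hull_inc)
      then obtain y where y: "y \<in> ?A" "x - y \<in> span F" by (rule project_mod_decomp)
      have "x = (x - y) + y" by simp
      then show "x \<in> {x + y | x y. x \<in> span F \<and> y \<in> span ?A}" using y span_base[of y ?A] by blast
    qed
    have "span G \<subseteq> {x + y | x y. x \<in> span F \<and> y \<in> span ?A}"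
      using G' subspace_sums[OF subspace_span subspace_span] by (rule span_minimal)
    then show "z \<in> {x + y | x y. x \<in> span F \<and> y \<in> span ?A}" if "z \<in> span G" for z using that by blast
  qed
  then have "dim (span G) + dim (span F \<inter> span ?A) = dim (span F) + dim (span ?A)"
    using dim_sums_Int[OF subspace_span[of F] subspace_span[of ?A]] by simp
  then show ?thesis unfolding int by (simp add: dim_face F G)
qed

text \<open>
  A point in the relative interior of the cone over \<open>G\<close> stays there, and a point of the cone over
  \<open>H\<close> stays in that cone, when a large multiple of the sum of the vertices of \<open>F\<close> is added.
\<close>

lemma project_mod_imp_subset:
  assumes F: "F \<in> \<T>" and G: "G \<in> \<T>" and H: "H \<in> \<T>" and FG: "F \<subseteq> G" and FH: "F \<subseteq> H"
    and eq: "project_mod F (convex_cone hull G) = project_mod F (convex_cone hull H)"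
  shows "G \<subseteq> H"
proof -
  let ?x = "\<Sum>v\<in>vertices G. v"
  have VF: "vertices F \<subseteq> vertices G" using FG subset_iff_vertices[OF F G] by simp
  have fG: "finite (vertices G)" using face_vertices(2)[OF G] .
  have fF: "finite (vertices F)" using face_vertices(2)[OF F] .
  have "?x \<in> open_cone (vertices G)"
    unfolding open_cone_def by (intro CollectI exI[of _ "\<lambda>_. 1"]) simp
  then have "?x \<in> convex_cone hull G" using open_cone_subset_cone[OF G] by blast
  then obtain p where p: "p \<in> project_mod F (convex_cone hull G)" "?x - p \<in> span F"
    by (rule project_mod_decomp)
  have "p \<in> project_mod F (convex_cone hull H)" using p(1) eq by simp
  then obtain y where y: "y \<in> convex_cone hull H" "y - p \<in> span F"
    unfolding project_mod_def by blast
  have "(y - p) - (?x - p) \<in> span F" using y(2) p(2) by (rule span_diff)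
  then have "y - ?x \<in> span (vertices F)" by (simp add: span_face[OF F])
  then obtain c where c: "y - ?x = (\<Sum>v\<in>vertices F. c v *\<^sub>R v)"
    unfolding span_finite[OF fF] by blast
  \<comment> \<open>\<open>K\<close> dominates every \<open>\<bar>c v\<bar>\<close>, so
    \<open>K + c v \<ge> 0\<close>. Thus \<open>?z\<close> is \<open>y\<close> plus a vector of the
    cone over \<open>F\<close>, hence in the cone over \<open>H\<close>, and also \<open>?x\<close>
    plus a nonnegative combination, hence in the open cone over \<open>G\<close>.\<close>
  define K where "K = (\<Sum>v\<in>vertices F. \<bar>c v\<bar>)"
  have K: "K + c v \<ge> 0" if "v \<in> vertices F" for v
  proof -
    have "\<bar>c v\<bar> \<le> K" unfolding K_def using fF that by (intro member_le_sum) auto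
    then show ?thesis by linarith
  qed
  have K0: "K \<ge> 0" unfolding K_def by (simp add: sum_nonneg)
  let ?z = "y + (\<Sum>v\<in>vertices F. K *\<^sub>R v)"
  have "(\<Sum>v\<in>vertices F. K *\<^sub>R v) \<in> convex_cone hull F"
    unfolding cone_over_face[OF F] using K0 by (intro CollectI exI[of _ "\<lambda>_. K"]) simp
  then have "(\<Sum>v\<in>vertices F. K *\<^sub>R v) \<in> convex_cone hull H" using hull_mono[OF FH, of convex_cone] by blast
  then have zH: "?z \<in> convex_cone hull H" using y(1) by (intro convex_cone_hull_add)
  have "?z = ?x + (\<Sum>v\<in>vertices F. (K + c v) *\<^sub>R v)"
    using c by (simp add: algebra_simps sum.distrib)
  also have "\<dots> = (\<Sum>v\<in>vertices G. (1 + (if v \<in> vertices F then K + c v else 0)) *\<^sub>R v)"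
    unfolding sum_scaleR_extend[OF fG VF] by (simp only: scaleR_add_left sum.distrib scaleR_one)
  finally have "?z \<in> open_cone (vertices G)"
    unfolding open_cone_def using K
    by (intro CollectI exI[of _ "\<lambda>v. 1 + (if v \<in> vertices F then K + c v else 0)"]) (auto simp: add_pos_nonneg)
  then show ?thesis using zH by (rule open_cone_imp_subset[OF G H])
qed

lemma link_fan_eq:
  assumes F: "F \<in> \<T>"
  shows "link_fan (cone_fan \<T>) F = (\<lambda>G. project_mod F (convex_cone hull G)) ` {G \<in> \<T>. F \<subseteq> G}"
  unfolding link_fan_def cone_fan_def using face_subset_cone_iff[OF F] by auto

text \<open>The h-polynomial of the link fan, indexed by faces containing \<open>F\<close> instead
  of projected cones; \<open>fan_h_link_fan\<close> identifies the two.\<close>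

definition link_poly :: "'a set \<Rightarrow> int poly" where
  "link_poly F = (\<Sum>G | G \<in> \<T> \<and> F \<subseteq> G.
     [:0, 1:] ^ (card (vertices G) - card (vertices F)) * [:1, -1:] ^ (d - card (vertices G)))"

text \<open>By \<open>project_mod_imp_subset\<close>, distinct faces containing \<open>F\<close>
  have distinct projected cones, so the sum can be reindexed by faces. Projection lowers the
  dimensions of cones and fan alike by \<open>card (vertices F)\<close>, so the exponent of
  \<open>1 - t\<close> stays \<open>d - card (vertices G)\<close>.\<close>

lemma fan_h_link_fan:
  assumes F: "F \<in> \<T>"
  shows "fan_h (d - card (vertices F)) (link_fan (cone_fan \<T>) F) i = coeff (link_poly F) i"
proof -
  let ?P = "\<lambda>G. project_mod F (convex_cone hull G)" and ?n = "d - card (vertices F)"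
  have inj: "inj_on ?P {G \<in> \<T>. F \<subseteq> G}"
    using project_mod_imp_subset[OF F] by (intro inj_onI) blast
  have "(\<Sum>\<tau>\<in>link_fan (cone_fan \<T>) F. [:0, 1:] ^ dim \<tau> * [:1, -1:] ^ (?n - dim \<tau>))
      = (\<Sum>G | G \<in> \<T> \<and> F \<subseteq> G. [:0, 1:] ^ dim (?P G) * [:1, -1:] ^ (?n - dim (?P G)) :: int poly)"
    unfolding link_fan_eq[OF F] by (subst sum.reindex[OF inj]) simp
  also have "\<dots> = link_poly F"
    unfolding link_poly_def
  proof (rule sum.cong)
    fix G assume "G \<in> {G \<in> \<T>. F \<subseteq> G}"
    then have G: "G \<in> \<T>" "F \<subseteq> G" by auto
    have "card (vertices F) \<le> card (vertices G)"
      using G subset_iff_vertices[OF F G(1)] by (intro card_mono face_vertices(2)) auto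
    then show "[:0, 1:] ^ dim (?P G) * [:1, -1:] ^ (?n - dim (?P G))
      = ([:0, 1:] ^ (card (vertices G) - card (vertices F)) * [:1, -1:] ^ (d - card (vertices G)) :: int poly)"
      using dim_project_mod[OF F G] by simp
  qed simp
  finally show ?thesis unfolding fan_h_def by simp
qed

lemma degree_link_poly:
  assumes F: "F \<in> \<T>"
  shows "degree (link_poly F) \<le> d - card (vertices F)"
  unfolding link_poly_def
proof (rule degree_sum_le)
  fix G assume "G \<in> {G \<in> \<T>. F \<subseteq> G}"
  then have G: "G \<in> \<T>" "F \<subseteq> G" by auto
  have "card (vertices F) \<le> card (vertices G)"
    using G subset_iff_vertices[OF F G(1)] by (intro card_mono face_vertices(2)) auto
  moreover have "card (vertices G) \<le> d" using card_vertices_le[OF G(1)] .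
  ultimately have "(card (vertices G) - card (vertices F)) + (d - card (vertices G)) = d - card (vertices F)"
    by simp
  moreover have "degree ([:0, 1:] ^ m * [:1, -1:] ^ n :: int poly) \<le> m + n" for m n
    using degree_mult_le[of "[:0, 1:] ^ m :: int poly" "[:1, -1:] ^ n"]
      degree_power_le[of "[:0, 1:] :: int poly" m] degree_power_le[of "[:1, -1:] :: int poly" n] by simp
  ultimately show "degree ([:0, 1:] ^ (card (vertices G) - card (vertices F)) * [:1, -1:] ^ (d - card (vertices G)) :: int poly)
      \<le> d - card (vertices F)" by metis
qed (simp add: finite_faces)

section \<open>The \<open>\<delta>\<close>-polynomial\<close>

lemma finite_level: "finite {x \<in> N. \<Psi> x = real m}"
proof -
  have "finite {x \<in> N \<inter> open_cone (vertices F). \<Psi> x = real m}" if F: "F \<in> \<T>" for F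
    using finite_cone_fibre[OF lattice face_vertices(2)[OF F] independent_vertices[OF F]
        vertices_subset_lattice[OF F] ints support_sum[OF F], of "vertices F" m]
    by (simp only: open_cone_eq_half_open)
  then have "finite (\<Union>F\<in>\<T>. {x \<in> N \<inter> open_cone (vertices F). \<Psi> x = real m})"
    using finite_faces by (intro finite_UN_I)
  moreover have "{x \<in> N. \<Psi> x = real m} \<subseteq> (\<Union>F\<in>\<T>. {x \<in> N \<inter> open_cone (vertices F). \<Psi> x = real m})"
    using lattice_decomposition by blast
  ultimately show ?thesis by (rule rev_finite_subset)
qed

lemma finite_region: "finite (region N \<Psi> m \<inter> N)"
proof -
  have nonneg: "\<Psi> x \<ge> 0" if "x \<in> N" for x
    using pos[OF span_base[OF that]] support_zero by (cases "x = 0") (auto simp: less_imp_le)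
  have "region N \<Psi> m \<inter> N \<subseteq> (\<Union>k\<le>m. {x \<in> N. \<Psi> x = real k})"
  proof
    fix x assume "x \<in> region N \<Psi> m \<inter> N"
    then have x: "x \<in> N" "\<Psi> x \<le> real m" unfolding region_def by auto
    obtain z where z: "\<Psi> x = of_int z" using ints[OF x(1)] by (rule Ints_cases)
    have "z \<ge> 0" using nonneg[OF x(1)] z by simp
    then have "\<Psi> x = real (nat z)" using z by simp
    moreover have "nat z \<le> m" using x(2) \<open>\<Psi> x = real (nat z)\<close> by simp
    ultimately show "x \<in> (\<Union>k\<le>m. {x \<in> N. \<Psi> x = real k})" using x(1) by blast
  qed
  then show ?thesis by (rule finite_subset) (simp add: finite_level)
qed

text \<open>Multiplication by \<open>1 - t\<close> takes successive differences, and integrality of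
  \<open>\<Psi>\<close> on \<open>N\<close> makes each difference count exactly one level. In degree
  0, nonnegativity identifies \<open>\<Psi> \<le> 0\<close> with \<open>\<Psi> = 0\<close>.\<close>

lemma ehrhart_series:
  "Abs_fps (\<lambda>m. int (ehrhart N \<Psi> m)) * (1 - fps_X) = gen_series \<Psi> N"
proof (rule fps_ext)
  fix m
  have nonneg: "\<Psi> x \<ge> 0" if "x \<in> N" for x
    using pos[OF span_base[OF that]] support_zero by (cases "x = 0") (auto simp: less_imp_le)
  show "(Abs_fps (\<lambda>m. int (ehrhart N \<Psi> m)) * (1 - fps_X)) $ m = gen_series \<Psi> N $ m"
  proof (cases m)
    case 0
    have "region N \<Psi> 0 \<inter> N = {x \<in> N. \<Psi> x = 0}"
      unfolding region_def using nonneg span_base by (auto intro: antisym)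
    then show ?thesis by (simp add: 0 gen_series_def ehrhart_def)
  next
    case (Suc n)
    have "\<Psi> x \<le> real n \<or> \<Psi> x = real (Suc n)" if x: "x \<in> N" "\<Psi> x \<le> real (Suc n)" for x
    proof -
      obtain z where z: "\<Psi> x = of_int z" using ints[OF x(1)] by (rule Ints_cases)
      then have "z \<le> int (Suc n)" using x(2) by linarith
      then have "z \<le> int n \<or> z = int (Suc n)" by linarith
      then show ?thesis using z by auto
    qed
    then have "region N \<Psi> (Suc n) \<inter> N = (region N \<Psi> n \<inter> N) \<union> {x \<in> N. \<Psi> x = real (Suc n)}"
      unfolding region_def using span_base by fastforce
    moreover have "card ((region N \<Psi> n \<inter> N) \<union> {x \<in> N. \<Psi> x = real (Suc n)})
        = card (region N \<Psi> n \<inter> N) + card {x \<in> N. \<Psi> x = real (Suc n)}"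
      by (intro card_Un_disjoint finite_region finite_level) (auto simp: region_def)
    ultimately have "ehrhart N \<Psi> (Suc n) = ehrhart N \<Psi> n + card {x \<in> N. \<Psi> x = real (Suc n)}"
      unfolding ehrhart_def by simp
    then show ?thesis by (simp add: Suc gen_series_def right_diff_distrib)
  qed
qed

definition box_series :: "'a set \<Rightarrow> int poly" where
  "box_series S = (\<Sum>w\<in>open_box S \<inter> N. [:0, 1:] ^ nat \<lfloor>\<Psi> w\<rfloor>)"

text \<open>Subsets of the vertex set of a simplex correspond to its subfaces, which turns the sum
  of \<open>gen_series_open_cone\<close> into one over faces of \<open>\<T>\<close>.\<close>

lemma gen_series_face:
  assumes F: "F \<in> \<T>"
  shows "gen_series \<Psi> (N \<inter> open_cone (vertices F)) * (1 - fps_X) ^ card (vertices F) =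
    (\<Sum>G | G \<in> \<T> \<and> G \<subseteq> F. fps_of_poly ([:0, 1:] ^ (card (vertices F) - card (vertices G)) * box_series (vertices G)))"
proof -
  let ?f = "\<lambda>S. fps_of_poly ([:0, 1:] ^ (card (vertices F) - card S) * box_series S)"
  have bij: "bij_betw vertices {G \<in> \<T>. G \<subseteq> F} (Pow (vertices F))"
  proof (rule bij_betw_byWitness[of _ "\<lambda>S. convex hull S"])
    show "\<forall>G\<in>{G \<in> \<T>. G \<subseteq> F}. convex hull (vertices G) = G" using face_vertices(3) by auto
    show "\<forall>S\<in>Pow (vertices F). vertices (convex hull S) = S" using subface(2)[OF F] by blast
    show "vertices ` {G \<in> \<T>. G \<subseteq> F} \<subseteq> Pow (vertices F)" using subset_iff_vertices[OF _ F] by blast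
    show "(\<lambda>S. convex hull S) ` Pow (vertices F) \<subseteq> {G \<in> \<T>. G \<subseteq> F}"
    proof clarify
      fix S assume S: "S \<subseteq> vertices F"
      show "convex hull S \<in> \<T> \<and> convex hull S \<subseteq> F"
        using subface[OF F S] subset_iff_vertices[OF _ F, of "convex hull S"] S by simp
    qed
  qed
  have "gen_series \<Psi> (N \<inter> open_cone (vertices F)) * (1 - fps_X) ^ card (vertices F) =
      (\<Sum>S\<in>Pow (vertices F). fps_X ^ card (vertices F - S) * (\<Sum>w\<in>open_box S \<inter> N. fps_X ^ nat \<lfloor>\<Psi> w\<rfloor>))"
    by (rule gen_series_open_cone[OF lattice face_vertices(2)[OF F] independent_vertices[OF F]
          vertices_subset_lattice[OF F] ints support_sum[OF F]])
  also have "\<dots> = (\<Sum>S\<in>Pow (vertices F). ?f S)"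
  proof (rule sum.cong)
    fix S assume "S \<in> Pow (vertices F)"
    then have "card (vertices F - S) = card (vertices F) - card S"
      using face_vertices(2)[OF F] by (simp add: card_Diff_subset finite_subset)
    then show "fps_X ^ card (vertices F - S) * (\<Sum>w\<in>open_box S \<inter> N. fps_X ^ nat \<lfloor>\<Psi> w\<rfloor>) = ?f S"
      unfolding box_series_def by (simp add: fps_of_poly_mult fps_of_poly_power fps_of_poly_sum)
  qed simp
  also have "\<dots> = (\<Sum>G | G \<in> \<T> \<and> G \<subseteq> F. ?f (vertices G))"
    by (rule sum.reindex_bij_betw[OF bij, symmetric])
  finally show ?thesis .
qed

lemma ehrhart_series_poly:
  "Abs_fps (\<lambda>m. int (ehrhart N \<Psi> m)) * (1 - fps_X) ^ (d + 1)
     = fps_of_poly (\<Sum>G\<in>\<T>. box_series (vertices G) * link_poly G)"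
proof -
  let ?X = "[:0, 1:] :: int poly" and ?Y = "[:1, -1:] :: int poly"
  let ?t = "\<lambda>F G. ?X ^ (card (vertices F) - card (vertices G)) * box_series (vertices G) * ?Y ^ (d - card (vertices F))"
  have Y: "fps_of_poly ?Y = 1 - fps_X" by (simp add: fps_of_poly_pCons)
  have "Abs_fps (\<lambda>m. int (ehrhart N \<Psi> m)) * (1 - fps_X) ^ (d + 1) = gen_series \<Psi> N * (1 - fps_X) ^ d"
    unfolding ehrhart_series[symmetric] by (simp add: mult.assoc)
  also have "gen_series \<Psi> N = (\<Sum>F\<in>\<T>. gen_series \<Psi> (N \<inter> open_cone (vertices F)))"
  proof -
    have "finite {x \<in> N \<inter> open_cone (vertices F). \<Psi> x = real m}" for F m
      by (rule finite_subset[OF _ finite_level[of m]]) blast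
    then have "gen_series \<Psi> (\<Union>F\<in>\<T>. N \<inter> open_cone (vertices F)) = (\<Sum>F\<in>\<T>. gen_series \<Psi> (N \<inter> open_cone (vertices F)))"
      by (intro gen_series_UN[OF finite_faces open_cone_disjoint])
    then show ?thesis using lattice_decomposition by metis
  qed
  also have "\<dots> * (1 - fps_X) ^ d = (\<Sum>F\<in>\<T>. gen_series \<Psi> (N \<inter> open_cone (vertices F)) * (1 - fps_X) ^ d)"
    by (rule sum_distrib_right)
  also have "\<dots> = (\<Sum>F\<in>\<T>. \<Sum>G | G \<in> \<T> \<and> G \<subseteq> F. fps_of_poly (?t F G))"
  proof (rule sum.cong)
    fix F assume F: "F \<in> \<T>"
    let ?k = "card (vertices F)" and ?g = "gen_series \<Psi> (N \<inter> open_cone (vertices F))"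
    \<comment> \<open>The open cone over \<open>F\<close> absorbs
      \<open>card (vertices F) \<le> d\<close> of the factors; the remaining ones become the powers
      of \<open>1 - t\<close> in the link polynomials.\<close>
    have "?g * (1 - fps_X) ^ d = ?g * (1 - fps_X) ^ ?k * (1 - fps_X) ^ (d - ?k)"
      using card_vertices_le[OF F] by (simp add: mult.assoc flip: power_add)
    also have "\<dots> = (\<Sum>G | G \<in> \<T> \<and> G \<subseteq> F. fps_of_poly (?t F G))"
      unfolding gen_series_face[OF F] sum_distrib_right
      by (simp only: fps_of_poly_mult[of _ "_ ^ _"] fps_of_poly_mult[of "_ * _"] fps_of_poly_power Y)
    finally show "?g * (1 - fps_X) ^ d = (\<Sum>G | G \<in> \<T> \<and> G \<subseteq> F. fps_of_poly (?t F G))" .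
  qed simp
  \<comment> \<open>Exchanging the sums groups the terms by the face \<open>G\<close> that carries
    the box point.\<close>
  also have "\<dots> = (\<Sum>G\<in>\<T>. \<Sum>F | F \<in> \<T> \<and> G \<subseteq> F. fps_of_poly (?t F G))"
    by (rule sum.swap_restrict[OF finite_faces finite_faces])
  also have "\<dots> = (\<Sum>G\<in>\<T>. fps_of_poly (box_series (vertices G) * link_poly G))"
  proof (rule sum.cong)
    fix G
    have "(\<Sum>F | F \<in> \<T> \<and> G \<subseteq> F. ?t F G) = box_series (vertices G) * link_poly G"
      unfolding link_poly_def sum_distrib_left by (intro sum.cong) (simp_all only: mult_ac)
    then show "(\<Sum>F | F \<in> \<T> \<and> G \<subseteq> F. fps_of_poly (?t F G)) = fps_of_poly (box_series (vertices G) * link_poly G)"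
      by (simp only: fps_of_poly_sum[symmetric])
  qed simp
  finally show ?thesis by (simp only: fps_of_poly_sum)
qed

lemma box_weight_le:
  assumes F: "F \<in> \<T>" and w: "w \<in> open_box (vertices F)"
  shows "nat \<lfloor>\<Psi> w\<rfloor> \<le> card (vertices F)"
  using open_box_support(3)[OF lattice face_vertices(2)[OF F] independent_vertices[OF F]
      vertices_subset_lattice[OF F] ints support_sum[OF F] subset_refl w] by linarith

text \<open>The definite description requires a degree bound and uniqueness. The box polynomial of
  \<open>G\<close> has degree at most \<open>card (vertices G)\<close> and the link polynomial at
  most the complementary \<open>d - card (vertices G)\<close>; uniqueness is injectivity of
  \<open>fps_of_poly\<close>.\<close>

lemma delta_poly_eq:
  "delta_poly d (ehrhart N \<Psi>) = (\<Sum>G\<in>\<T>. box_series (vertices G) * link_poly G)"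
  unfolding delta_poly_def
proof (rule the_equality)
  let ?p = "\<Sum>G\<in>\<T>. box_series (vertices G) * link_poly G"
  have "degree ?p \<le> d"
  proof (rule degree_sum_le[OF finite_faces])
    fix G assume G: "G \<in> \<T>"
    have "degree (box_series (vertices G)) \<le> card (vertices G)"
      unfolding box_series_def
    proof (rule degree_sum_le)
      show "finite (open_box (vertices G) \<inter> N)"
        by (rule finite_open_box[OF lattice face_vertices(2)[OF G] independent_vertices[OF G]
              vertices_subset_lattice[OF G] ints support_sum[OF G] subset_refl])
      fix w assume "w \<in> open_box (vertices G) \<inter> N"
      then show "degree ([:0, 1:] ^ nat \<lfloor>\<Psi> w\<rfloor> :: int poly) \<le> card (vertices G)"
        using box_weight_le[OF G] degree_power_le[of "[:0, 1:] :: int poly" "nat \<lfloor>\<Psi> w\<rfloor>"] by fastforce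
    qed
    then show "degree (box_series (vertices G) * link_poly G) \<le> d"
      using degree_mult_le[of "box_series (vertices G)" "link_poly G"] degree_link_poly[OF G]
        card_vertices_le[OF G] by linarith
  qed
  then show "degree ?p \<le> d \<and> Abs_fps (\<lambda>m. int (ehrhart N \<Psi> m)) * (1 - fps_X) ^ (d + 1) = fps_of_poly ?p"
    using ehrhart_series_poly by blast
  show "q = ?p"
    if "degree q \<le> d \<and> Abs_fps (\<lambda>m. int (ehrhart N \<Psi> m)) * (1 - fps_X) ^ (d + 1) = fps_of_poly q" for q
    using that unfolding ehrhart_series_poly fps_of_poly_eq_iff by simp
qed

lemma delta_vector_eq:
  "delta_vector N \<Psi> d i =
     complex_h d \<T> i +
     (\<Sum>F\<in>\<T> - {{}}. \<Sum>v\<in>Box F \<inter> N.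
        shift (fan_h (d - card (vertices F)) (link_fan (cone_fan \<T>) F)) (nat \<lfloor>\<Psi> v\<rfloor>) i)"
proof -
  \<comment> \<open>Multiplication by a power of \<open>t\<close> shifts coefficients, so a box
    point of weight \<open>k\<close> shifts the h-vector by \<open>k\<close>.\<close>
  have shift: "coeff ([:0, 1:] ^ k * p) i = shift (coeff p) k i" for k and p :: "int poly"
    using coeff_monom_mult[of 1 k p i] by (simp add: monom_altdef shift_def)
  have face: "coeff (box_series (vertices F) * link_poly F) i = (\<Sum>v\<in>Box F \<inter> N.
      shift (fan_h (d - card (vertices F)) (link_fan (cone_fan \<T>) F)) (nat \<lfloor>\<Psi> v\<rfloor>) i)" if F: "F \<in> \<T>" for F
  proof -
    have "Box F = open_box (vertices F)" unfolding Box_def open_box_def ..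
    moreover have "fan_h (d - card (vertices F)) (link_fan (cone_fan \<T>) F) = coeff (link_poly F)"
      using fan_h_link_fan[OF F] by blast
    ultimately show ?thesis unfolding box_series_def sum_distrib_right coeff_sum shift by simp
  qed
  \<comment> \<open>The empty face has the single box point 0 of weight 0, and all faces contain it,
    so its term is the h-vector of \<open>\<T>\<close>.\<close>
  have "box_series (vertices {}) = 1"
    using is_lattice_zero[OF lattice] by (simp add: box_series_def vertices_empty support_zero)
  moreover have "coeff (link_poly {}) i = complex_h d \<T> i"
    by (simp add: link_poly_def complex_h_def vertices_empty)
  moreover have "delta_vector N \<Psi> d i = coeff (box_series (vertices {}) * link_poly {}) i
      + (\<Sum>F\<in>\<T> - {{}}. coeff (box_series (vertices F) * link_poly F) i)"
    unfolding delta_vector_def delta_poly_eq coeff_sum by (rule sum.remove[OF finite_faces empty_face])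
  ultimately show ?thesis by (simp add: face)
qed

end

section \<open>The formula for complete Gorenstein fans\<close>

theorem theorem1p3:
  fixes N :: "'a::euclidean_space set" and \<Sigma> \<T> :: "'a set set"
    and \<Psi> :: "'a \<Rightarrow> real" and d :: nat
  assumes "is_lattice d N"
    and "complete_fan N \<Sigma>"
    and "gorenstein_support N \<Sigma> \<Psi>"
    and "boundary_triangulation N \<Psi> \<T>"
  shows "\<forall>i\<le>d. delta_vector N \<Psi> d i =
           complex_h d \<T> i +
           (\<Sum>F\<in>\<T> - {{}}. \<Sum>v\<in>Box F \<inter> N.
              shift (fan_h (d - card (vertices F)) (link_fan (cone_fan \<T>) F)) (nat \<lfloor>\<Psi> v\<rfloor>) i)"
proof -
  have triangulation: "simplicial_complex \<T>" "{} \<in> \<T>" "\<And>v. {v} \<in> \<T> \<Longrightarrow> v \<in> N"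
    "\<Union>\<T> = {v \<in> span N. \<Psi> v = 1}"
    using assms(4) frontier_of_region[OF assms(1-3)] unfolding boundary_triangulation_def by auto
  interpret lattice_triangulation N \<Psi> d \<T>
    by unfold_locales
       (fact assms(1) support_scaleR[OF assms(1-3)] support_pos[OF assms(1-3)] support_Ints[OF assms(1-3)]
          triangulation)+
  show ?thesis using delta_vector_eq by blast
qed

end
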